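(* There exists a numerical constant $c>0$ such that for every $w\in A_\infty^+$ and every $p>e^{c[w]_{A_\infty^+}}$ we have $w\in A_p^+$ and $$[w]_{A_p^+}\le \exp\big(\exp(c[w]_{A_\infty^+})\big).$$
   Context: A weight $w$ is a non-negative, locally integrable function on $\mathbb{R}$. Write $w(a,b)=\int_{(a,b)}w(t)\,dt$ (and similarly for other functions), and $\mathbf{1}_E$ for the indicator function of $E$. For $f\in L^1_{\mathrm{loc}}(\mathbb{R})$ the backward one-sided Hardy-Littlewood maximal operator is $$\mathsf{M}^-f(x)=\sup_{h>0}\frac1h\int_{x-h}^{x}|f(t)|\,dt,\qquad x\in\mathbb{R}.$$ The (Fujii-Wilson type) one-sided $A_\infty^+$ constant is $$[w]_{A_\infty^+}=\sup_{a<b}\frac{1}{w(a,b)}\int_{(a,b)}\mathsf{M}^-(w\mathbf{1}_{(a,b)})(x)\,dx,$$ where intervals with $w(a,b)=0$ contribute $0$ (convention $0/0=0$), and $w\in A_\infty^+$ means $[w]_{A_\infty^+}<+\infty$. For $1<p<\infty$, $$[w]_{A_p^+}=\sup_{a<b<c}\frac{w(a,b)}{|(a,c)|}\Big(\frac{\sigma(b,c)}{|(a,c)|}\Big)^{p-1},\qquad \sigma=w^{-\frac{1}{p-1}},$$ with the convention $0\cdot\infty=0$, the supremum being over all real $a<b<c$ (this $c$ is unrelated to the numerical constant), and $w\in A_p^+$ means $[w]_{A_p^+}<+\infty$. A numerical constant is an absolute constant, independent of $w$ and $p$. *)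

theory Defs
  imports "HOL-Analysis.Analysis"
begin

definition weight :: "(real \<Rightarrow> real) \<Rightarrow> bool" where
  "weight w \<longleftrightarrow> (\<forall>x. 0 \<le> w x) \<and> (\<forall>a b. w absolutely_integrable_on {a..b})"

(* f(a,b), the Lebesgue integral of f over the open interval (a,b), possibly infinite *)
definition mass :: "(real \<Rightarrow> ennreal) \<Rightarrow> real \<Rightarrow> real \<Rightarrow> ennreal" where
  "mass f a b = (\<integral>\<^sup>+t\<in>{a<..<b}. f t \<partial>lebesgue)"

(* real powers on [0,\<infinity>]; negative powers send 0 to \<infinity> and \<infinity> to 0,
   unlike powr on the reals, where 0 powr r = 0 for every r *)
definition ennpowr :: "ennreal \<Rightarrow> real \<Rightarrow> ennreal" where
  "ennpowr x r =
    (if r = 0 then 1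
     else if x = 0 then (if r > 0 then 0 else \<infinity>)
     else if x = \<infinity> then (if r > 0 then \<infinity> else 0)
     else ennreal (enn2real x powr r))"

definition maximal_minus :: "(real \<Rightarrow> real) \<Rightarrow> real \<Rightarrow> ennreal" where
  "maximal_minus f x =
    (SUP h\<in>{0<..}. (\<integral>\<^sup>+t\<in>{x-h..x}. ennreal \<bar>f t\<bar> \<partial>lebesgue) / ennreal h)"

(* if w(a,b) = 0 then the numerator vanishes as well, and 0 / 0 = 0 in ennreal *)
definition A_inf_const :: "(real \<Rightarrow> real) \<Rightarrow> ennreal" where
  "A_inf_const w =
    (SUP (a, b)\<in>{(a, b). a < b}.
       mass (maximal_minus (\<lambda>t. w t * indicator {a<..<b} t)) a b
         / mass (\<lambda>t. ennreal (w t)) a b)"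

definition A_inf_plus :: "(real \<Rightarrow> real) set" where
  "A_inf_plus = {w. weight w \<and> A_inf_const w < \<infinity>}"

(* the dual weight w^(-1/(p-1)), equal to \<infinity> where w vanishes *)
definition dual_weight :: "real \<Rightarrow> (real \<Rightarrow> real) \<Rightarrow> real \<Rightarrow> ennreal" where
  "dual_weight p w t = ennpowr (ennreal (w t)) (- 1 / (p - 1))"

(* meaningful for p > 1; 0 * \<infinity> = 0 in ennreal *)
definition A_p_const :: "real \<Rightarrow> (real \<Rightarrow> real) \<Rightarrow> ennreal" where
  "A_p_const p w =
    (SUP (a, b, c)\<in>{(a, b, c). a < b \<and> b < c}.
       mass (\<lambda>t. ennreal (w t)) a b / ennreal (c - a)
         * ennpowr (mass (dual_weight p w) b c / ennreal (c - a)) (p - 1))"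

definition A_p_plus :: "real \<Rightarrow> (real \<Rightarrow> real) set" where
  "A_p_plus p = {w. weight w \<and> A_p_const p w < \<infinity>}"

end

theory Submission
  imports Defs
begin

text \<open>
  Fix $a < b < c$ with $w(a,b) > 0$, write $A$ for the one-sided $A_\infty$ constant, and let
  $l = w(a,b)/(c-a)$. The theorem follows once the sublevel sets of $w$ in $(b,c)$ are known to be
  small, namely $|\{w < \kappa^k t\}| \le \rho^k (c-a)$ with $t = l/2$, where $\kappa$ and
  $1 - \rho$ are of size $e^{-CA}$. For $s = 1/(p-1)$ below a threshold $e^{-C'A}$ these bounds sum
  to $\int_{(b,c)} w^{-s} \le t^{-s} (c-a)(1 + sB)$ with $B \le e^{C''A}$ independent of $s$, and
  $(1 + sB)^{1/s} \le e^B$ makes the bound uniform in $p$ and doubly exponential in $A$.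

  The sublevel sets are controlled by a rising sun argument. With $F$ a primitive of $w$, the open
  set \<open>mound t a c\<close> consists of the points of $(a,c)$ that have average of $w$ above $t$ over some
  interval to their left and below $t$ over some interval to their right. Every component $(y,x)$ of
  it has average exactly $t$, while the averages over all $(u,x)$ are at most $t$. Therefore,
  inside $(y,x)$, the mound of level $2^k t$ contains almost all points with $w > 2^k t$, and the
  maximal function of $w 1_{(y,x)}$ is at least $2^k t$ on it. If
  $\{w > t/2\}$ filled less than the proportion $2^{-n-2}$ of $(y,x)$, then each of the first $n$ of these mounds would contribute a
  fixed fraction of $w(y,x)$ to the integral of the maximal function, which is at most $A\,w(y,x)$;
  hence $n \le 8A$. Thus $w > t/2$ on a proportion at least $\alpha = 2^{-n-2}$ of each component
  as soon as $n > 8A$ (\<open>measure_above_half_average_ge\<close>).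

  On the other hand, $w$ has average only $\kappa t$ on a mound of level $\kappa t$, so $w > t/2$
  holds on only a small part of it. Passing from level $t$ to level $\kappa t = \alpha t/4$ therefore
  loses a fixed proportion of the measure (\<open>mound_contracts\<close>), provided that the
  mounds are nested. This is arranged by moving the left endpoint to a point $a' \le b$ from which
  all averages to the right are at least $l$ (\<open>exists_anchor\<close>). Finally, almost every point of
  $(b,c)$ with $w < \kappa^k t$ lies in the mound of that level, and a telescoping sum over the
  mounds bounds $w^{-s}$ (\<open>dual_integral_le\<close>).
\<close>

section \<open>Open subsets of the line and comparison of measures\<close>

lemma bounded_open_component:
  fixes U :: "real set"
  assumes "open U" "U \<subseteq> {a<..<b}" "z \<in> U"
  obtains y x where "a \<le> y" "y < z" "z < x" "x \<le> b" "y \<notin> U" "x \<notin> U" "{y<..<x} \<subseteq> U"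
proof -
  define P where "P = {a..z} - U"
  define Q where "Q = {z..b} - U"
  have z: "a < z" "z < b" using assms by auto
  have cP: "compact P" and cQ: "compact Q"
    unfolding P_def Q_def using assms(1) by (auto intro: compact_diff)
  have aP: "a \<in> P" and bQ: "b \<in> Q" unfolding P_def Q_def using z assms(2) by auto
  obtain y where y: "y \<in> P" "\<And>t. t \<in> P \<Longrightarrow> t \<le> y" using compact_attains_sup[OF cP] aP by blast
  obtain x where x: "x \<in> Q" "\<And>t. t \<in> Q \<Longrightarrow> x \<le> t" using compact_attains_inf[OF cQ] bQ by blast
  have "y \<noteq> z" "x \<noteq> z" using y(1) x(1) assms(3) by (auto simp: P_def Q_def)
  moreover have "{y<..<x} \<subseteq> U"
  proof
    fix t assume t: "t \<in> {y<..<x}"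
    show "t \<in> U"
    proof (rule ccontr)
      assume n: "t \<notin> U"
      show False
      proof (cases "t \<le> z")
        case True
        then have "t \<in> P" using n t y(1) by (auto simp: P_def)
        then show False using y(2) t by fastforce
      next
        case False
        then have "t \<in> Q" using n t x(1) by (auto simp: Q_def)
        then show False using x(2) t by fastforce
      qed
    qed
  qed
  ultimately show thesis
    using y(1) x(1) by (intro that[of y x]) (auto simp: P_def Q_def)
qed

text \<open>
  The components of $U$ are countably many disjoint intervals, and exactly the intervals inside $U$
  whose endpoints are outside.
\<close>
lemma emeasure_open_le_if_components_le:
  fixes U :: "real set"
  assumes s: "sets M = sets lebesgue" "sets N = sets lebesgue"
    and U: "open U" "U \<subseteq> {a<..<b}"
    and le: "\<And>y x. a \<le> y \<Longrightarrow> y < x \<Longrightarrow> x \<le> b \<Longrightarrow> y \<notin> U \<Longrightarrow> x \<notin> U \<Longrightarrow> {y<..<x} \<subseteq> U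
      \<Longrightarrow> emeasure M {y<..<x} \<le> emeasure N {y<..<x}"
  shows "emeasure M U \<le> emeasure N U"
proof -
  define J where "J = {(y, x). a \<le> y \<and> y < x \<and> x \<le> b \<and> y \<notin> U \<and> x \<notin> U \<and> {y<..<x} \<subseteq> U}"
  define I where "I = (\<lambda>(y, x). {y<..<x::real})"
  have disj: "disjoint_family_on I J"
    unfolding disjoint_family_on_def
  proof (intro ballI impI, rule ccontr)
    fix i j assume ij: "i \<in> J" "j \<in> J" "i \<noteq> j" "I i \<inter> I j \<noteq> {}"
    obtain y x y' x' where e: "i = (y, x)" "j = (y', x')" by (cases i; cases j) auto
    obtain z where "z \<in> I i" "z \<in> I j" using ij(4) by blast
    then have z: "y < z" "z < x" "y' < z" "z < x'" by (auto simp: e I_def)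
    have A: "\<And>t. y < t \<Longrightarrow> t < x \<Longrightarrow> t \<in> U" and B: "\<And>t. y' < t \<Longrightarrow> t < x' \<Longrightarrow> t \<in> U"
      and n: "y \<notin> U" "x \<notin> U" "y' \<notin> U" "x' \<notin> U"
      using ij(1,2) by (auto simp: e J_def)
    have "\<not> y < y'" "\<not> x' < x" "\<not> y' < y" "\<not> x < x'"
      using A[of y'] A[of x'] B[of y] B[of x] n z by auto
    then have "y = y'" "x = x'" by auto
    then show False using ij(3) e by simp
  qed
  have UJ: "U = (\<Union>j\<in>J. I j)"
  proof
    show "U \<subseteq> (\<Union>j\<in>J. I j)"
    proof
      fix z assume "z \<in> U"
      from bounded_open_component[OF U this] obtain y x where
        "a \<le> y" "y < z" "z < x" "x \<le> b" "y \<notin> U" "x \<notin> U" "{y<..<x} \<subseteq> U" .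
      then show "z \<in> (\<Union>j\<in>J. I j)" by (intro UN_I[of "(y, x)"]) (auto simp: J_def I_def)
    qed
  qed (auto simp: J_def I_def)
  have "countable (I ` J)"
  proof (rule countable_disjoint_open_subsets)
    show "disjoint (I ` J)" using disj by (rule disjoint_family_on_disjoint_image)
  qed (auto simp: I_def)
  moreover have "inj_on I J"
  proof (rule inj_onI)
    fix i j assume ij: "i \<in> J" "j \<in> J" "I i = I j"
    have "I i \<noteq> {}" using ij(1) by (auto simp: I_def J_def)
    with disj ij show "i = j" unfolding disjoint_family_on_def by blast
  qed
  ultimately have cJ: "countable J" using countable_image_inj_on by blast
  have "emeasure M U = (\<integral>\<^sup>+j. emeasure M (I j) \<partial>count_space J)"
    unfolding UJ by (rule emeasure_UN_countable[OF _ cJ disj]) (auto simp: s I_def)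
  also have "\<dots> \<le> (\<integral>\<^sup>+j. emeasure N (I j) \<partial>count_space J)"
    by (rule nn_integral_mono) (auto simp: J_def I_def intro!: le)
  also have "\<dots> = emeasure N U"
    unfolding UJ by (rule emeasure_UN_countable[symmetric, OF _ cJ disj]) (auto simp: s I_def)
  finally show ?thesis .
qed

lemma decseq_open_approximation:
  fixes B :: "real set"
  assumes B: "B \<in> sets lebesgue" "B \<subseteq> {a<..<b}"
  obtains V :: "nat \<Rightarrow> real set" where "\<And>n. open (V n)" "\<And>n. B \<subseteq> V n" "\<And>n. V n \<subseteq> {a<..<b}"
    "decseq V" "(\<Inter>n. V n) - B \<in> null_sets lebesgue"
proof -
  have "\<exists>T. open T \<and> B \<subseteq> T \<and> emeasure lebesgue (T - B) < ennreal (1 / Suc n)" for n :: nat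
    by (rule sets_lebesgue_outer_open[OF B(1), of "1 / Suc n"]) auto
  then obtain T where T: "\<And>n. open (T n)" "\<And>n. B \<subseteq> T n"
      "\<And>n. emeasure lebesgue (T n - B) < ennreal (1 / Suc n)" by metis
  define V where "V n = {a<..<b} \<inter> (\<Inter>k\<le>n. T k)" for n
  show thesis
  proof (rule that)
    show "open (V n)" for n unfolding V_def using T(1) by (intro open_Int open_INT) auto
    show "B \<subseteq> V n" for n unfolding V_def using T(2) B(2) by auto
    show "V n \<subseteq> {a<..<b}" for n unfolding V_def by auto
    show "decseq V" unfolding V_def decseq_def by auto
    have m: "T n - B \<in> sets lebesgue" for n using T(1) B(1) by auto
    have mV: "(\<Inter>n. V n) - B \<in> sets lebesgue"
      using \<open>\<And>n. open (V n)\<close> B(1) by (intro sets.Diff sets.countable_INT) auto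
    have "emeasure lebesgue ((\<Inter>n. V n) - B) \<le> ennreal (1 / Suc n)" for n
      by (rule order_trans[OF emeasure_mono[OF _ m[of n]] less_imp_le[OF T(3)[of n]]]) (auto simp: V_def)
    then have "emeasure lebesgue ((\<Inter>n. V n) - B) \<le> 0"
      using LIMSEQ_le_const[OF tendsto_ennrealI[OF LIMSEQ_Suc[OF lim_inverse_n']]] by simp
    then show "(\<Inter>n. V n) - B \<in> null_sets lebesgue" using mV by (simp add: null_sets_def)
  qed
qed

text \<open>
  A substitute for Lebesgue's differentiation theorem: apply the comparison on components to open
  sets that shrink to $B$ up to a null set. With one of the two measures a multiple of Lebesgue
  measure and the other one a weight, it compares the weight with its averages.
\<close>
lemma emeasure_le_if_intervals_le:
  fixes B :: "real set"
  assumes s: "sets M = sets lebesgue" "sets N = sets lebesgue"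
    and N: "null_sets lebesgue \<subseteq> null_sets N" "emeasure N {a<..<b} < \<infinity>"
    and B: "B \<in> sets lebesgue" "B \<subseteq> {a<..<b}"
    and le: "\<And>p q. a \<le> p \<Longrightarrow> p < q \<Longrightarrow> q \<le> b \<Longrightarrow> emeasure M (B \<inter> {p<..<q}) \<le> emeasure N {p<..<q}"
  shows "emeasure M B \<le> emeasure N B"
proof -
  obtain V where V: "\<And>n. open (V n)" "\<And>n. B \<subseteq> V n" "\<And>n. V n \<subseteq> {a<..<b}"
    "decseq V" "(\<Inter>n. V n) - B \<in> null_sets lebesgue"
    using decseq_open_approximation[OF B] by blast
  have mV: "V n \<in> sets N" for n using V(1) s by auto
  have restr: "emeasure (density M (indicator B)) X = emeasure M (B \<inter> X)" if "X \<in> sets lebesgue" for X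
    using that B s by (intro emeasure_restricted) auto
  have "emeasure M B \<le> emeasure N (V n)" for n
  proof -
    have "emeasure (density M (indicator B)) (V n) \<le> emeasure N (V n)"
      by (rule emeasure_open_le_if_components_le[OF _ _ V(1) V(3)])
        (auto simp: s restr intro!: le)
    then show ?thesis using V(1,2) by (simp add: restr Int_absorb2)
  qed
  then have "emeasure M B \<le> (INF n. emeasure N (V n))" by (intro INF_greatest)
  also have "\<dots> = emeasure N (\<Inter>n. V n)"
  proof (rule INF_emeasure_decseq)
    show "emeasure N (V i) \<noteq> \<infinity>" for i
      using emeasure_mono[OF V(3)[of i], of N] N(2) s by (auto simp: top_unique)
  qed (use mV V(4) in auto)
  also have "\<dots> = emeasure N B"
  proof -
    have "emeasure N (\<Inter>n. V n) = emeasure N (B \<union> ((\<Inter>n. V n) - B))"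
      by (rule arg_cong[of _ _ "emeasure N"]) (use V(2) in auto)
    also have "\<dots> = emeasure N B"
      by (rule emeasure_Un_null_set) (use V(5) N(1) B s in auto)
    finally show ?thesis .
  qed
  finally show ?thesis .
qed

text \<open>
  Turns the conclusion of \<open>emeasure_le_if_intervals_le\<close> into a statement about almost all points.
\<close>
lemma null_set_if_integral_le:
  assumes f: "f \<in> borel_measurable M" "g \<in> borel_measurable M" and B: "B \<in> sets M"
    and lt: "\<And>x. x \<in> B \<Longrightarrow> g x < (f x :: ennreal)"
    and fin: "emeasure (density M g) B < \<infinity>"
    and le: "emeasure (density M f) B \<le> emeasure (density M g) B"
  shows "B \<in> null_sets M"
proof -
  note [measurable] = f B
  have eq: "emeasure (density M f) B = (\<integral>\<^sup>+x. f x * indicator B x \<partial>M)"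
    "emeasure (density M g) B = (\<integral>\<^sup>+x. g x * indicator B x \<partial>M)"
    by (auto simp: emeasure_density f B)
  have "AE x in M. f x * indicator B x \<le> g x * indicator B x"
  proof (rule ccontr)
    assume n: "\<not> (AE x in M. f x * indicator B x \<le> g x * indicator B x)"
    have "(\<integral>\<^sup>+x. g x * indicator B x \<partial>M) < (\<integral>\<^sup>+x. f x * indicator B x \<partial>M)"
      by (rule nn_integral_less[OF _ _ _ _ n])
        (use fin eq in \<open>auto split: split_indicator intro!: AE_I2 less_imp_le[OF lt]\<close>)
    then show False using le eq by simp
  qed
  then have "AE x in M. x \<notin> B"
    by eventually_elim (auto dest: lt split: split_indicator_asm)
  then show ?thesis using B by (subst (asm) AE_iff_null_sets[symmetric]) auto
qed

section \<open>A weight and its primitive\<close>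

text \<open>
  The primitive $F$ turns statements about averages of $w$ into statements about a continuous
  function of one variable.
\<close>
locale weight_primitive =
  fixes w F :: "real \<Rightarrow> real"
  assumes w_nonneg: "0 \<le> w x"
    and w_measurable[measurable]: "w \<in> borel_measurable lebesgue"
    and F_continuous: "continuous_on UNIV F"
    and F_mono: "mono F"
    and mass_eq: "a \<le> b \<Longrightarrow> mass (\<lambda>t. ennreal (w t)) a b = ennreal (F b - F a)"
begin

definition "\<nu> = density lebesgue (\<lambda>x. ennreal (w x))"

lemma sets_\<nu>[simp, measurable_cong]: "sets \<nu> = sets lebesgue"
  by (simp add: \<nu>_def)

lemma \<nu>_eq: "X \<in> sets lebesgue \<Longrightarrow> emeasure \<nu> X = (\<integral>\<^sup>+x\<in>X. ennreal (w x) \<partial>lebesgue)"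
  by (simp add: \<nu>_def emeasure_density)

lemma \<nu>_Ioo: "a \<le> b \<Longrightarrow> emeasure \<nu> {a<..<b} = ennreal (F b - F a)"
  using mass_eq by (simp add: \<nu>_eq mass_def)

lemma null_sets_\<nu>: "null_sets lebesgue \<subseteq> null_sets \<nu>"
  using absolutely_continuousI_density[of "\<lambda>x. ennreal (w x)" lebesgue]
  by (simp add: \<nu>_def absolutely_continuous_def)

lemma \<nu>_Ioc: "a \<le> b \<Longrightarrow> emeasure \<nu> {a<..b} = ennreal (F b - F a)"
proof -
  assume ab: "a \<le> b"
  have "{b} \<in> null_sets \<nu>" using null_sets_\<nu> by auto
  then have "emeasure \<nu> ({a<..<b} \<union> {b}) = emeasure \<nu> {a<..<b}"
    by (intro emeasure_Un_null_set) auto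
  moreover have "{a<..b} = {a<..<b} \<union> {b}" if "a < b" using that by auto
  ultimately show ?thesis using ab \<nu>_Ioo[OF ab] by (cases "a = b") auto
qed

lemma \<nu>_le:
  assumes "X \<in> sets lebesgue" "AE x in lebesgue. x \<in> X \<longrightarrow> w x \<le> t"
  shows "emeasure \<nu> X \<le> ennreal t * emeasure lebesgue X"
proof -
  have "emeasure \<nu> X \<le> (\<integral>\<^sup>+x. ennreal t * indicator X x \<partial>lebesgue)"
    unfolding \<nu>_eq[OF assms(1)] using assms(2)
    by (intro nn_integral_mono_AE) (auto elim!: eventually_mono intro!: ennreal_leI split: split_indicator)
  then show ?thesis using assms(1) by (simp add: nn_integral_cmult_indicator)
qed

lemma \<nu>_ge:
  assumes "X \<in> sets lebesgue" "AE x in lebesgue. x \<in> X \<longrightarrow> t \<le> w x"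
  shows "ennreal t * emeasure lebesgue X \<le> emeasure \<nu> X"
proof -
  have "(\<integral>\<^sup>+x. ennreal t * indicator X x \<partial>lebesgue) \<le> emeasure \<nu> X"
    unfolding \<nu>_eq[OF assms(1)] using assms(2)
    by (intro nn_integral_mono_AE) (auto elim!: eventually_mono intro!: ennreal_leI split: split_indicator)
  then show ?thesis using assms(1) by (simp add: nn_integral_cmult_indicator)
qed

lemma sets_level:
  assumes "X \<in> sets lebesgue"
  shows "{z \<in> X. t < w z} \<in> sets lebesgue" "{z \<in> X. w z < t} \<in> sets lebesgue"
    "{z \<in> X. w z \<le> t} \<in> sets lebesgue"
proof -
  have "X \<inter> {z \<in> space lebesgue. t < w z} \<in> sets lebesgue"
    "X \<inter> {z \<in> space lebesgue. w z < t} \<in> sets lebesgue"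
    "X \<inter> {z \<in> space lebesgue. w z \<le> t} \<in> sets lebesgue"
    by (rule sets.Int[OF assms]; measurable)+
  then show "{z \<in> X. t < w z} \<in> sets lebesgue" "{z \<in> X. w z < t} \<in> sets lebesgue"
    "{z \<in> X. w z \<le> t} \<in> sets lebesgue" by (simp_all add: Int_def)
qed

lemma open_left:
  "open {z \<in> {a<..<b}. \<exists>u\<in>{a..<z}. t * (z - u) < F z - F u}" (is "open ?S")
proof -
  have "?S = {a<..<b} \<inter> (\<Union>u\<in>{a..}. {u<..} \<inter> {z. t * (z - u) < F z - F u})" by auto
  moreover have "open {z. t * (z - u) < F z - F u}" for u
    by (intro open_Collect_less continuous_intros F_continuous)
  ultimately show ?thesis by (auto intro!: open_Int open_UN)
qed

lemma open_right:
  "open {z \<in> {a<..<b}. \<exists>v\<in>{z<..b}. F v - F z < t * (v - z)}" (is "open ?S")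
proof -
  have "?S = {a<..<b} \<inter> (\<Union>v\<in>{..b}. {..<v} \<inter> {z. F v - F z < t * (v - z)})" by auto
  moreover have "open {z. F v - F z < t * (v - z)}" for v
    by (intro open_Collect_less continuous_intros F_continuous)
  ultimately show ?thesis by (auto intro!: open_Int open_UN)
qed

text \<open>
  Let $B$ be the set of points with $w > t$ such that all averages of $w$ over intervals in $[a,b]$
  that end there are at most $t$. Then $B \cap (p,q)$ lies in
  $(p,x]$ where $x$ is its supremum, and $w(p,x) \le t\,(q - p)$ by continuity. Hence
  $w(B) \le t\,|B|$, and a set on which $w > t$ can satisfy this only if it is null.
\<close>
lemma AE_left_average_gt:
  assumes t: "0 \<le> t"
  shows "AE z in lebesgue. z \<in> {a<..<b} \<longrightarrow> t < w z \<longrightarrow> (\<exists>u\<in>{a..<z}. t * (z - u) < F z - F u)"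
proof -
  let ?S = "{z \<in> {a<..<b}. \<exists>u\<in>{a..<z}. t * (z - u) < F z - F u}"
  define B where "B = {z \<in> {a<..<b}. t < w z} - ?S"
  have S: "?S \<in> sets lebesgue" using open_left by auto
  have B: "B \<in> sets lebesgue" unfolding B_def by (rule sets.Diff[OF _ S], rule sets_level) auto
  have Bab: "B \<subseteq> {a<..<b}" by (auto simp: B_def)
  let ?N = "density lebesgue (\<lambda>_. ennreal t)"
  have N: "emeasure ?N X = ennreal t * emeasure lebesgue X" if "X \<in> sets lebesgue" for X
    using that by (simp add: emeasure_density_const)
  have "emeasure \<nu> B \<le> emeasure ?N B"
  proof (rule emeasure_le_if_intervals_le[OF _ _ _ _ B Bab])
    show "null_sets lebesgue \<subseteq> null_sets ?N"
      using absolutely_continuousI_density[of "\<lambda>x. ennreal t" lebesgue]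
      by (simp add: absolutely_continuous_def)
    show "emeasure ?N {a<..<b} < \<infinity>"
      by (cases "a \<le> b") (auto simp: N ennreal_mult_less_top)
    fix p q assume pq: "a \<le> p" "p < q" "q \<le> b"
    show "emeasure \<nu> (B \<inter> {p<..<q}) \<le> emeasure ?N {p<..<q}"
    proof (cases "B \<inter> {p<..<q} = {}")
      case False
      define X where "X = B \<inter> {p<..<q}"
      define x where "x = Sup X"
      have X: "X \<noteq> {}" "bdd_above X" using False by (auto simp: X_def intro: bdd_aboveI[of _ q])
      have le: "z \<le> x" if "z \<in> X" for z unfolding x_def using X(2) that by (intro cSup_upper)
      have px: "p \<le> x" using X(1) le by (force simp: X_def)
      have xq: "x \<le> q" unfolding x_def using X(1) by (intro cSup_least) (auto simp: X_def)
      have "closed {z. F z - F p \<le> t * (z - p)}"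
        by (intro closed_Collect_le continuous_intros F_continuous)
      moreover have "X \<subseteq> {z. F z - F p \<le> t * (z - p)}"
        using pq by (force simp: X_def B_def not_less)
      ultimately have "closure X \<subseteq> {z. F z - F p \<le> t * (z - p)}" by (rule closure_minimal[rotated])
      then have "F x - F p \<le> t * (x - p)"
        using closure_contains_Sup[OF X] by (auto simp: x_def)
      also have "\<dots> \<le> t * (q - p)" using xq t by (simp add: mult_left_mono)
      finally have *: "F x - F p \<le> t * (q - p)" .
      have "emeasure \<nu> X \<le> emeasure \<nu> {p<..x}"
        using le by (intro emeasure_mono) (auto simp: X_def)
      also have "\<dots> \<le> ennreal (t * (q - p))" unfolding \<nu>_Ioc[OF px] using * by (rule ennreal_leI)
      also have "\<dots> = emeasure ?N {p<..<q}"
        using pq t by (simp add: N ennreal_mult)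
      finally show ?thesis by (simp add: X_def)
    qed simp
  qed simp_all
  then have le: "emeasure \<nu> B \<le> emeasure ?N B" .
  have finB: "emeasure lebesgue B < \<infinity>"
    by (rule le_less_trans[OF emeasure_mono[OF Bab]]) (cases "a \<le> b"; simp)+
  have "B \<in> null_sets lebesgue"
  proof (rule null_set_if_integral_le[OF _ _ B _ _ le[unfolded \<nu>_def]])
    show "ennreal t < ennreal (w x)" if "x \<in> B" for x
      using that t by (simp add: B_def ennreal_less_iff)
    show "emeasure ?N B < \<infinity>" using finB B by (simp add: N ennreal_mult_less_top)
  qed simp_all
  then show ?thesis by (rule AE_I') (auto simp: B_def)
qed

text \<open>
  The mirror image of the previous argument, with the infimum of $B \cap (p,q)$.
\<close>
lemma AE_right_average_lt:
  assumes t: "0 \<le> t"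
  shows "AE z in lebesgue. z \<in> {a<..<b} \<longrightarrow> w z < t \<longrightarrow> (\<exists>v\<in>{z<..b}. F v - F z < t * (v - z))"
proof -
  let ?S = "{z \<in> {a<..<b}. \<exists>v\<in>{z<..b}. F v - F z < t * (v - z)}"
  define B where "B = {z \<in> {a<..<b}. w z < t} - ?S"
  have S: "?S \<in> sets lebesgue" using open_right by auto
  have B: "B \<in> sets lebesgue" unfolding B_def by (rule sets.Diff[OF _ S], rule sets_level) auto
  have Bab: "B \<subseteq> {a<..<b}" by (auto simp: B_def)
  let ?N = "density lebesgue (\<lambda>_. ennreal t)"
  have N: "emeasure ?N X = ennreal t * emeasure lebesgue X" if "X \<in> sets lebesgue" for X
    using that by (simp add: emeasure_density_const)
  have fin: "emeasure \<nu> {a<..<b} < \<infinity>"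
    by (cases "a \<le> b") (auto simp: \<nu>_Ioo)
  have "emeasure ?N B \<le> emeasure \<nu> B"
  proof (rule emeasure_le_if_intervals_le[OF _ _ null_sets_\<nu> fin B Bab])
    fix p q assume pq: "a \<le> p" "p < q" "q \<le> b"
    show "emeasure ?N (B \<inter> {p<..<q}) \<le> emeasure \<nu> {p<..<q}"
    proof (cases "B \<inter> {p<..<q} = {}")
      case False
      define X where "X = B \<inter> {p<..<q}"
      define x where "x = Inf X"
      have X: "X \<noteq> {}" "bdd_below X" using False by (auto simp: X_def intro: bdd_belowI[of _ p])
      have le: "x \<le> z" if "z \<in> X" for z unfolding x_def using X(2) that by (intro cInf_lower)
      have xq: "x \<le> q" using X(1) le by (force simp: X_def)
      have px: "p \<le> x" unfolding x_def using X(1) by (intro cInf_greatest) (auto simp: X_def)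
      have "closed {z. t * (q - z) \<le> F q - F z}"
        by (intro closed_Collect_le continuous_intros F_continuous)
      moreover have "X \<subseteq> {z. t * (q - z) \<le> F q - F z}"
        using pq by (force simp: X_def B_def not_less)
      ultimately have "closure X \<subseteq> {z. t * (q - z) \<le> F q - F z}" by (rule closure_minimal[rotated])
      then have "t * (q - x) \<le> F q - F x"
        using closure_contains_Inf[OF X] by (auto simp: x_def)
      also have "\<dots> \<le> F q - F p" using monoD[OF F_mono px] by simp
      finally have *: "t * (q - x) \<le> F q - F p" .
      have "emeasure ?N X \<le> emeasure ?N {x..<q}"
        using le by (intro emeasure_mono) (auto simp: X_def)
      also have "\<dots> = ennreal (t * (q - x))"
        using xq t by (simp add: N ennreal_mult)
      also have "\<dots> \<le> emeasure \<nu> {p<..<q}" using * pq by (simp add: \<nu>_Ioo ennreal_leI)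
      finally show ?thesis by (simp add: X_def)
    qed simp
  qed simp_all
  then have le: "emeasure ?N B \<le> emeasure \<nu> B" .
  have "B \<in> null_sets lebesgue"
  proof (rule null_set_if_integral_le[OF _ _ B _ _ le[unfolded \<nu>_def]])
    show "ennreal (w x) < ennreal t" if "x \<in> B" for x
      using that t by (simp add: B_def ennreal_less_iff w_nonneg)
    show "emeasure (density lebesgue (\<lambda>x. ennreal (w x))) B < \<infinity>"
      using emeasure_mono[OF Bab, of \<nu>] fin by (simp add: \<nu>_def)
  qed simp_all
  then show ?thesis by (rule AE_I') (auto simp: B_def)
qed

section \<open>Mounds\<close>

text \<open>
  The superlevel part of the function $F(z) - t z$ that is enclosed by lower values on both sides.
  The condition on the right, which the usual rising sun construction does not have, forces
  both endpoints of each component to the same height, also near the ends of $(a,b)$.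
\<close>
definition mound :: "real \<Rightarrow> real \<Rightarrow> real \<Rightarrow> real set" where
  "mound t a b = {z \<in> {a<..<b}. (\<exists>u\<in>{a..<z}. t * (z - u) < F z - F u) \<and>
    (\<exists>v\<in>{z<..b}. F v - F z < t * (v - z))}"

lemma mound_subset: "mound t a b \<subseteq> {a<..<b}"
  by (auto simp: mound_def)

lemma open_mound: "open (mound t a b)"
proof -
  have "mound t a b = {z \<in> {a<..<b}. \<exists>u\<in>{a..<z}. t * (z - u) < F z - F u} \<inter>
     {z \<in> {a<..<b}. \<exists>v\<in>{z<..b}. F v - F z < t * (v - z)}"
    by (auto simp: mound_def)
  then show ?thesis by (simp only: open_Int[OF open_left open_right])
qed

text \<open>
  Put $\Phi(z) = F(z) - t z$ and let $m$ be the larger of the minima of $\Phi$ to the left and to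
  the right of $z$. The component of $z$ is the interval around $z$ on which $\Phi > m$: on the side
  where the minimum is $m$, nothing is lower than its endpoints, which therefore are not in the mound.
\<close>
lemma mound_around_point:
  assumes z: "z \<in> mound t a b"
  obtains y x where "a \<le> y" "y < z" "z < x" "x \<le> b" "y \<notin> mound t a b" "x \<notin> mound t a b"
    "{y<..<x} \<subseteq> mound t a b" "F x - F y = t * (x - y)"
    "\<And>u. y < u \<Longrightarrow> u < x \<Longrightarrow> F x - F u \<le> t * (x - u)"
proof -
  define \<Phi> where "\<Phi> u = F u - t * u" for u
  have mound_iff: "s \<in> mound t a b \<longleftrightarrow> a < s \<and> s < b \<and>
      (\<exists>u. a \<le> u \<and> u < s \<and> \<Phi> u < \<Phi> s) \<and> (\<exists>v. s < v \<and> v \<le> b \<and> \<Phi> v < \<Phi> s)" for s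
    unfolding mound_def \<Phi>_def by (auto simp: algebra_simps Bex_def)
  have cont: "continuous_on S \<Phi>" for S
    unfolding \<Phi>_def by (intro continuous_intros continuous_on_subset[OF F_continuous]) auto
  have ab: "a < z" "z < b" using z mound_iff by auto
  obtain p where p: "p \<in> {a..z}" "\<And>u. u \<in> {a..z} \<Longrightarrow> \<Phi> p \<le> \<Phi> u"
    using continuous_attains_inf[OF _ _ cont, of "{a..z}"] ab by auto
  obtain q where q: "q \<in> {z..b}" "\<And>u. u \<in> {z..b} \<Longrightarrow> \<Phi> q \<le> \<Phi> u"
    using continuous_attains_inf[OF _ _ cont, of "{z..b}"] ab by auto
  define m where "m = max (\<Phi> p) (\<Phi> q)"
  obtain u0 v0 where "a \<le> u0" "u0 < z" "\<Phi> u0 < \<Phi> z" "z < v0" "v0 \<le> b" "\<Phi> v0 < \<Phi> z"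
    using z[unfolded mound_iff] by blast
  then have pz: "\<Phi> p < \<Phi> z" "\<Phi> q < \<Phi> z" using p(2)[of u0] q(2)[of v0] by auto
  then have mz: "m < \<Phi> z" by (simp add: m_def)
  have comp: "compact {u \<in> {c..d}. \<Phi> u \<le> m}" for c d
  proof -
    have "closed {u. \<Phi> u \<le> m}" by (intro closed_Collect_le cont continuous_intros)
    then have "compact ({c..d} \<inter> {u. \<Phi> u \<le> m})" by (intro compact_Int_closed) auto
    then show ?thesis by (simp add: Int_def)
  qed
  have "p \<in> {u \<in> {a..z}. \<Phi> u \<le> m}" "q \<in> {u \<in> {z..b}. \<Phi> u \<le> m}"
    using p q by (auto simp: m_def)
  then obtain y x where y: "y \<in> {a..z}" "\<Phi> y \<le> m" "\<And>u. u \<in> {a..z} \<Longrightarrow> \<Phi> u \<le> m \<Longrightarrow> u \<le> y"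
    and x: "x \<in> {z..b}" "\<Phi> x \<le> m" "\<And>u. u \<in> {z..b} \<Longrightarrow> \<Phi> u \<le> m \<Longrightarrow> x \<le> u"
    using compact_attains_sup[OF comp[of a z]] compact_attains_inf[OF comp[of z b]] by blast
  have yz: "y < z" "z < x" using y(1,2) x(1,2) mz by (auto simp: less_le)
  have above: "m < \<Phi> u" if "y < u" "u < x" for u
    using y(3)[of u] x(3)[of u] that y(1) x(1) by (cases "u \<le> z") force+
  have ym: "\<Phi> y = m"
  proof (rule antisym[OF y(2)], rule ccontr)
    assume "\<not> m \<le> \<Phi> y"
    then obtain u where "y \<le> u" "u \<le> z" "\<Phi> u = m"
      using IVT'[OF _ _ _ cont, of y m z] mz yz by auto
    then show False using y(3)[of u] y(1) \<open>\<not> m \<le> \<Phi> y\<close> by force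
  qed
  have xm: "\<Phi> x = m"
  proof (rule antisym[OF x(2)], rule ccontr)
    assume "\<not> m \<le> \<Phi> x"
    then obtain u where "z \<le> u" "u \<le> x" "\<Phi> u = m"
      using IVT2'[OF _ _ _ cont, of x m z] mz yz by auto
    then show False using x(3)[of u] x(1) \<open>\<not> m \<le> \<Phi> x\<close> by force
  qed
  have side: "m = \<Phi> p \<or> m = \<Phi> q" by (auto simp: m_def)
  show thesis
  proof (rule that)
    show "{y<..<x} \<subseteq> mound t a b"
    proof
      fix u assume "u \<in> {y<..<x}"
      then have u: "y < u" "u < x" by auto
      show "u \<in> mound t a b" unfolding mound_iff
        using above[OF u] u ym xm y(1) x(1) by auto
    qed
    show "y \<notin> mound t a b"
      using side
    proof
      assume "m = \<Phi> p"
      have "m \<le> \<Phi> v" if "a \<le> v" "v < y" for v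
        using that p(2)[of v] yz \<open>m = \<Phi> p\<close> by auto
      then show ?thesis using ym by (force simp: mound_iff)
    next
      assume "m = \<Phi> q"
      have "m \<le> \<Phi> v" if "y < v" "v \<le> b" for v
        using that above[of v] q(2)[of v] yz \<open>m = \<Phi> q\<close> by (cases "v \<le> z") auto
      then show ?thesis using ym by (force simp: mound_iff)
    qed
    show "x \<notin> mound t a b"
      using side
    proof
      assume "m = \<Phi> q"
      have "m \<le> \<Phi> v" if "x < v" "v \<le> b" for v
        using that q(2)[of v] yz \<open>m = \<Phi> q\<close> by auto
      then show ?thesis using xm by (force simp: mound_iff)
    next
      assume "m = \<Phi> p"
      have "m \<le> \<Phi> v" if "a \<le> v" "v < x" for v
        using that above[of v] p(2)[of v] yz \<open>m = \<Phi> p\<close> by (cases "v \<le> z") auto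
      then show ?thesis using xm by (force simp: mound_iff)
    qed
    show "F x - F y = t * (x - y)" using xm ym by (simp add: \<Phi>_def algebra_simps)
    show "F x - F u \<le> t * (x - u)" if "y < u" "u < x" for u
      using above[OF that] xm by (simp add: \<Phi>_def algebra_simps)
  qed (use y(1) x(1) yz in auto)
qed

lemma mound_component:
  assumes "y < x" "y \<notin> mound t a b" "x \<notin> mound t a b" "{y<..<x} \<subseteq> mound t a b"
  shows "F x - F y = t * (x - y)" "\<And>u. y < u \<Longrightarrow> u < x \<Longrightarrow> F x - F u \<le> t * (x - u)"
proof -
  have "(y + x) / 2 \<in> mound t a b" using assms(1,4) by auto
  then obtain y' x' where c: "y' < (y + x) / 2" "(y + x) / 2 < x'" "y' \<notin> mound t a b" "x' \<notin> mound t a b"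
    "{y'<..<x'} \<subseteq> mound t a b" and r: "F x' - F y' = t * (x' - y')"
    "\<And>u. y' < u \<Longrightarrow> u < x' \<Longrightarrow> F x' - F u \<le> t * (x' - u)"
    by (rule mound_around_point) blast
  have "y' \<notin> {y<..<x}" "x' \<notin> {y<..<x}" "y \<notin> {y'<..<x'}" "x \<notin> {y'<..<x'}"
    using assms c by blast+
  then have "y' = y" "x' = x" using c(1,2) assms(1) by auto
  with r show "F x - F y = t * (x - y)" "\<And>u. y < u \<Longrightarrow> u < x \<Longrightarrow> F x - F u \<le> t * (x - u)" by auto
qed

lemma \<nu>_mound:
  assumes "0 \<le> t"
  shows "emeasure \<nu> (mound t a b) = ennreal t * emeasure lebesgue (mound t a b)"
proof -
  let ?N = "density lebesgue (\<lambda>_. ennreal t)"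
  have N: "emeasure ?N X = ennreal t * emeasure lebesgue X" if "X \<in> sets lebesgue" for X
    using that by (simp add: emeasure_density_const)
  have eq: "emeasure \<nu> {y<..<x} = emeasure ?N {y<..<x}"
    if "y < x" "y \<notin> mound t a b" "x \<notin> mound t a b" "{y<..<x} \<subseteq> mound t a b" for y x
    using mound_component(1)[OF that] that(1) assms by (simp add: \<nu>_Ioo N ennreal_mult)
  have "emeasure \<nu> (mound t a b) = emeasure ?N (mound t a b)"
    by (intro antisym; rule emeasure_open_le_if_components_le[OF _ _ open_mound mound_subset])
      (simp_all add: eq)
  then show ?thesis using open_mound by (simp add: N)
qed

section \<open>The one-sided maximal function and large values of the weight\<close>

lemma emeasure_finite:
  assumes "X \<in> sets lebesgue" "X \<subseteq> {a<..<b}"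
  shows "emeasure lebesgue X < \<infinity>" "emeasure \<nu> X < \<infinity>"
proof -
  show "emeasure lebesgue X < \<infinity>"
    by (rule le_less_trans[OF emeasure_mono[OF assms(2)]]) (cases "a \<le> b"; simp)+
  show "emeasure \<nu> X < \<infinity>"
    by (rule le_less_trans[OF emeasure_mono[OF assms(2)]]) (cases "a \<le> b"; simp add: \<nu>_Ioo)+
qed

lemma emeasure_lebesgue_bounded:
  fixes X :: "real set"
  assumes "X \<in> sets lebesgue" "X \<subseteq> {a<..<b}"
  shows "emeasure lebesgue X = ennreal (measure lebesgue X)"
  by (rule emeasure_eq_ennreal_measure) (use emeasure_finite(1)[OF assms] in force)

lemma fmeasurable_bounded:
  assumes "X \<in> sets lebesgue" "X \<subseteq> {a<..<b}"
  shows "X \<in> lmeasurable" "X \<in> fmeasurable \<nu>"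
  using emeasure_finite[OF assms] assms(1) by (auto intro: fmeasurableI)

lemma measure_\<nu>_Ioo: "a \<le> b \<Longrightarrow> measure \<nu> {a<..<b} = F b - F a"
  using monoD[OF F_mono, of a b] by (simp add: measure_def \<nu>_Ioo)

lemma measure_\<nu>_le:
  assumes "X \<in> sets lebesgue" "X \<subseteq> {a<..<b}" "AE x in lebesgue. x \<in> X \<longrightarrow> w x \<le> t" "0 \<le> t"
  shows "measure \<nu> X \<le> t * measure lebesgue X"
  using \<nu>_le[OF assms(1,3)] emeasure_finite[OF assms(1,2)] assms(4)
  by (simp add: emeasure_eq_ennreal_measure less_top[symmetric] flip: ennreal_mult)

lemma measure_\<nu>_ge:
  assumes "X \<in> sets lebesgue" "X \<subseteq> {a<..<b}" "AE x in lebesgue. x \<in> X \<longrightarrow> t \<le> w x" "0 \<le> t"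
  shows "t * measure lebesgue X \<le> measure \<nu> X"
  using \<nu>_ge[OF assms(1,3)] emeasure_finite[OF assms(1,2)] assms(4)
  by (simp add: emeasure_eq_ennreal_measure less_top[symmetric] flip: ennreal_mult)

lemma sets_mound[simp]: "mound t a b \<in> sets lebesgue"
  using open_mound by auto

lemma measure_\<nu>_mound: "0 \<le> t \<Longrightarrow> measure \<nu> (mound t a b) = t * measure lebesgue (mound t a b)"
  using \<nu>_mound[of t a b] by (simp add: measure_def enn2real_mult)

text \<open>
  The interval $[u,z]$ is one of those that compete in the supremum, and the truncation to $(a,b)$
  changes $w$ there at most at the endpoints.
\<close>
lemma maximal_minus_ge_average:
  assumes "a \<le> u" "u < z" "z \<le> b" "t * (z - u) \<le> F z - F u"
  shows "ennreal t \<le> maximal_minus (\<lambda>s. w s * indicator {a<..<b} s) z"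
proof -
  have "ennreal t \<le> ennreal ((F z - F u) / (z - u))"
    using assms(2,4) by (intro ennreal_leI) (simp add: field_simps)
  also have "\<dots> = ennreal (F z - F u) / ennreal (z - u)"
    using assms(2) monoD[OF F_mono, of u z] by (simp add: divide_ennreal)
  also have "ennreal (F z - F u) = (\<integral>\<^sup>+s\<in>{u<..<z}. ennreal (w s) \<partial>lebesgue)"
    using mass_eq[of u z] assms(2) by (simp add: mass_def)
  also have "\<dots> \<le> (\<integral>\<^sup>+s\<in>{z - (z - u)..z}. ennreal \<bar>w s * indicator {a<..<b} s\<bar> \<partial>lebesgue)"
    using assms(1-3) w_nonneg by (intro nn_integral_mono) (auto split: split_indicator)
  finally have "ennreal t \<le> (\<integral>\<^sup>+s\<in>{z - (z - u)..z}. ennreal \<bar>w s * indicator {a<..<b} s\<bar> \<partial>lebesgue) / ennreal (z - u)"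
    by (auto intro: divide_right_mono_ennreal)
  then show ?thesis
    unfolding maximal_minus_def using assms(2) by (intro SUP_upper2[of "z - u"]) auto
qed

text \<open>
  Rational levels suffice, so the exceptional null sets of \<open>AE_left_average_gt\<close> can be united.
\<close>
lemma AE_le_maximal_minus:
  "AE z in lebesgue. z \<in> {a<..<b} \<longrightarrow> ennreal (w z) \<le> maximal_minus (\<lambda>s. w s * indicator {a<..<b} s) z"
proof -
  have "AE z in lebesgue. \<forall>q\<in>\<rat> \<inter> {0..}. z \<in> {a<..<b} \<longrightarrow> q < w z \<longrightarrow> (\<exists>u\<in>{a..<z}. q * (z - u) < F z - F u)"
    using AE_left_average_gt[of _ a b] countable_rat
    by (subst AE_ball_countable) (auto simp del: greaterThanLessThan_iff)
  then show ?thesis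
  proof (rule eventually_mono, intro impI)
    fix z assume q: "\<forall>q\<in>\<rat> \<inter> {0..}. z \<in> {a<..<b} \<longrightarrow> q < w z \<longrightarrow> (\<exists>u\<in>{a..<z}. q * (z - u) < F z - F u)"
      and z: "z \<in> {a<..<b}"
    show "ennreal (w z) \<le> maximal_minus (\<lambda>s. w s * indicator {a<..<b} s) z" (is "_ \<le> ?M")
    proof (rule ccontr)
      assume n: "\<not> ennreal (w z) \<le> ?M"
      then obtain m where m: "?M = ennreal m" "0 \<le> m" by (cases ?M) auto
      with n have "m < w z" by (auto simp: not_le ennreal_less_iff)
      from Rats_dense_in_real[OF this] obtain r where r: "r \<in> \<rat>" "m < r" "r < w z" by blast
      with q z m(2) obtain u where "u \<in> {a..<z}" "r * (z - u) < F z - F u" by force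
      then have "ennreal r \<le> ?M" using z by (intro maximal_minus_ge_average) auto
      then show False using m r by (simp add: ennreal_le_iff)
    qed
  qed
qed

end

text \<open>
  The quotient that defines the $A_\infty$ constant carries information only for intervals of
  positive mass.
\<close>
locale weight_A_inf = weight_primitive +
  fixes A :: real
  assumes A_nonneg: "0 \<le> A"
    and mass_maximal_minus_le: "a < b \<Longrightarrow> F a < F b \<Longrightarrow>
      mass (maximal_minus (\<lambda>t. w t * indicator {a<..<b} t)) a b \<le> ennreal A * ennreal (F b - F a)"
begin

text \<open>
  Needed to absorb absolute constants into $e^{CA}$.
\<close>
lemma A_ge_1:
  assumes "a < b" "F a < F b"
  shows "1 \<le> A"
proof -
  have "ennreal (F b - F a) = mass (\<lambda>t. ennreal (w t)) a b" using assms by (simp add: mass_eq)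
  also have "\<dots> \<le> mass (maximal_minus (\<lambda>t. w t * indicator {a<..<b} t)) a b"
    unfolding mass_def using AE_le_maximal_minus[of a b]
    by (intro nn_integral_mono_AE) (auto elim!: eventually_mono split: split_indicator)
  also have "\<dots> \<le> ennreal A * ennreal (F b - F a)" using assms by (rule mass_maximal_minus_le)
  finally have "F b - F a \<le> A * (F b - F a)"
    using assms A_nonneg by (simp flip: ennreal_mult)
  then show ?thesis using assms(2) by simp
qed

text \<open>
  On the set $E$ where $w > l/2$ the weight has at least half of its mass $l\,(x-y)$. For a level
  $t_k = 2^{k+1} l$ with $k < n$, the part of $E$ outside the mound $G_k$ of level $t_k$ has $w \le t_k$
  almost everywhere, because the right-hand condition holds at all points of $(y,x)$. If $E$ is small,
  that part carries at most a quarter of the mass, so $t_k |G_k| = w(G_k)$ is at least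
  another quarter. Since the maximal function exceeds $t_k$ on $G_k$, summation over $k$ gives it
  the integral $n\,l\,(x-y)/8$ at least.
\<close>
lemma measure_above_half_average_ge:
  assumes n: "8 * A < real n" and l: "0 < l" and yx: "y < x"
    and avg: "F x - F y = l * (x - y)"
    and right: "\<And>u. y < u \<Longrightarrow> u < x \<Longrightarrow> F x - F u \<le> l * (x - u)"
  shows "(1 / 2) ^ (n + 2) * (x - y) \<le> measure lebesgue {z \<in> {y<..<x}. l / 2 < w z}"
proof (rule ccontr)
  define E where "E = {z \<in> {y<..<x}. l / 2 < w z}"
  define t where "t k = 2 ^ Suc k * l" for k
  define G where "G k = mound (t k) y x" for k
  assume "\<not> (1 / 2) ^ (n + 2) * (x - y) \<le> measure lebesgue {z \<in> {y<..<x}. l / 2 < w z}"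
  then have small: "measure lebesgue E < (1 / 2) ^ (n + 2) * (x - y)" by (simp add: E_def)
  have E: "E \<in> sets lebesgue" "E \<subseteq> {y<..<x}" unfolding E_def by (rule sets_level; simp) auto
  have G: "G k \<in> sets lebesgue" "G k \<subseteq> {y<..<x}" for k
    using mound_subset by (auto simp: G_def)
  have \<nu>E: "l * (x - y) / 2 \<le> measure \<nu> E"
  proof -
    have D: "{y<..<x} - E \<in> sets lebesgue" "{y<..<x} - E \<subseteq> {y<..<x}" using E by auto
    have "measure \<nu> ({y<..<x} - E) \<le> l / 2 * measure lebesgue ({y<..<x} - E)"
      using l by (intro measure_\<nu>_le[OF D]) (auto simp: E_def)
    also have "\<dots> \<le> l / 2 * measure lebesgue {y<..<x}"
      using l D by (intro mult_left_mono measure_mono_fmeasurable) auto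
    also have "\<dots> = l * (x - y) / 2" using yx by simp
    finally have "measure \<nu> ({y<..<x} - E) \<le> l * (x - y) / 2" .
    moreover have "measure \<nu> ({y<..<x} - E) = measure \<nu> {y<..<x} - measure \<nu> E"
      using E fmeasurable_bounded[of "{y<..<x}" y x] by (intro measure_Diff) (auto simp: fmeasurable_def)
    ultimately show ?thesis using yx avg by (simp add: measure_\<nu>_Ioo field_simps)
  qed
  have Gk: "l * (x - y) / 8 \<le> 2 ^ k * l * measure lebesgue (G k)" if k: "k < n" for k
  proof -
    have lt: "l < t k" "0 \<le> t k"
      using l one_less_power[of "2::real" "Suc k"] by (auto simp: t_def)
    have D: "E - G k \<in> sets lebesgue" "E - G k \<subseteq> {y<..<x}" using E G by auto
    have "AE z in lebesgue. z \<in> E - G k \<longrightarrow> w z \<le> t k"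
      using AE_left_average_gt[OF lt(2), of y x]
    proof (rule eventually_mono, intro impI)
      fix z assume z: "z \<in> {y<..<x} \<longrightarrow> t k < w z \<longrightarrow> (\<exists>u\<in>{y..<z}. t k * (z - u) < F z - F u)"
        and zE: "z \<in> E - G k"
      then have yzx: "y < z" "z < x" using E by auto
      have "F x - F z \<le> l * (x - z)" using right yzx by auto
      also have "\<dots> < t k * (x - z)" using lt yzx by (intro mult_strict_right_mono) auto
      finally have "\<exists>v\<in>{z<..x}. F v - F z < t k * (v - z)" using yzx by auto
      then have "\<not> (\<exists>u\<in>{y..<z}. t k * (z - u) < F z - F u)"
        using zE yzx by (auto simp: G_def mound_def)
      then show "w z \<le> t k" using z yzx by fastforce
    qed
    then have "measure \<nu> (E - G k) \<le> t k * measure lebesgue (E - G k)"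
      by (rule measure_\<nu>_le[OF D _ lt(2)])
    also have "\<dots> \<le> t k * measure lebesgue E"
      using lt D E fmeasurable_bounded(1)[OF E] by (intro mult_left_mono measure_mono_fmeasurable) auto
    also have "\<dots> \<le> t k * ((1 / 2) ^ (n + 2) * (x - y))"
      using lt small by (intro mult_left_mono) auto
    also have "\<dots> = (2 ^ Suc k * (1 / 2) ^ (n + 2)) * (l * (x - y))" by (simp add: t_def)
    also have "\<dots> \<le> (1 / 4) * (l * (x - y))"
    proof (rule mult_right_mono)
      have "(2::real) ^ Suc k \<le> 2 ^ n" using k by (intro power_increasing) auto
      then show "2 ^ Suc k * (1 / 2) ^ (n + 2) \<le> (1 / 4 :: real)"
        by (simp add: power_divide field_simps)
    qed (use l yx in auto)
    finally have 1: "measure \<nu> (E - G k) \<le> l * (x - y) / 4" by simp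
    have "measure \<nu> E \<le> measure \<nu> ((E - G k) \<union> G k)"
      using E G fmeasurable_bounded(2)[of "E - G k \<union> G k" y x]
      by (intro measure_mono_fmeasurable) auto
    also have "\<dots> \<le> measure \<nu> (E - G k) + measure \<nu> (G k)"
      using D G by (intro measure_Un_le) auto
    also have "measure \<nu> (G k) = t k * measure lebesgue (G k)"
      unfolding G_def by (rule measure_\<nu>_mound[OF lt(2)])
    finally show ?thesis using 1 \<nu>E by (simp add: t_def)
  qed
  (* A lower bound for the maximal function by a step function: since the levels double, the
     sum up to the last k with z in G k is at most 2 ^ Suc k * l. The second conjunct makes the
     induction work. *)
  define S where "S m z = (\<Sum>k<m. 2 ^ k * l * indicat_real (G k) z)" for m z
  have S_le: "ennreal (S m z) \<le> maximal_minus (\<lambda>s. w s * indicator {y<..<x} s) z \<and> S m z \<le> 2 ^ m * l" for m z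
  proof (induction m)
    case 0
    show ?case using l by (simp add: S_def)
  next
    case (Suc m)
    have step: "S (Suc m) z = S m z + 2 ^ m * l * indicat_real (G m) z"
      by (simp add: S_def)
    show ?case
    proof (cases "z \<in> G m")
      case True
      then obtain u where u: "y \<le> u" "u < z" "z < x" "t m * (z - u) < F z - F u"
        by (auto simp: G_def mound_def)
      then have "ennreal (t m) \<le> maximal_minus (\<lambda>s. w s * indicator {y<..<x} s) z"
        by (intro maximal_minus_ge_average) auto
      moreover have "S (Suc m) z \<le> t m" using True Suc by (simp add: step t_def mult.commute)
      ultimately show ?thesis by (auto intro: order_trans ennreal_leI simp: t_def)
    next
      case False
      have "2 ^ m * l \<le> 2 ^ Suc m * l" using l by simp
      then have "S m z \<le> 2 ^ Suc m * l" using Suc by linarith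
      then show ?thesis using Suc False by (simp add: step)
    qed
  qed
  have Sn: "(\<integral>\<^sup>+z\<in>{y<..<x}. ennreal (S n z) \<partial>lebesgue) = ennreal (\<Sum>k<n. 2 ^ k * l * measure lebesgue (G k))"
  proof -
    have "(\<integral>\<^sup>+z\<in>{y<..<x}. ennreal (S n z) \<partial>lebesgue) =
        (\<integral>\<^sup>+z. (\<Sum>k<n. ennreal (2 ^ k * l) * indicator (G k) z) \<partial>lebesgue)"
    proof (rule nn_integral_cong)
      fix z :: real
      have "ennreal (S n z) * indicator {y<..<x} z = ennreal (S n z)"
      proof (cases "z \<in> {y<..<x}")
        case False
        then have "z \<notin> G k" for k using G(2)[of k] by blast
        then have "S n z = 0" by (simp add: S_def)
        then show ?thesis by simp
      qed simp
      also have "\<dots> = (\<Sum>k<n. ennreal (2 ^ k * l) * indicator (G k) z)"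
        unfolding S_def using l
        by (subst sum_ennreal[symmetric]) (auto intro!: sum.cong split: split_indicator)
      finally show "ennreal (S n z) * indicator {y<..<x} z = \<dots>" .
    qed
    also have "\<dots> = (\<Sum>k<n. ennreal (2 ^ k * l) * emeasure lebesgue (G k))"
      using G(1) by (subst nn_integral_sum) (auto simp: nn_integral_cmult_indicator)
    also have "\<dots> = (\<Sum>k<n. ennreal (2 ^ k * l * measure lebesgue (G k)))"
      using emeasure_finite(1)[OF G] l
      by (intro sum.cong) (auto simp: emeasure_eq_ennreal_measure less_top[symmetric] ennreal_mult)
    also have "\<dots> = ennreal (\<Sum>k<n. 2 ^ k * l * measure lebesgue (G k))"
      using l by (intro sum_ennreal) auto
    finally show ?thesis .
  qed
  have "ennreal (real n * (l * (x - y) / 8)) \<le> (\<integral>\<^sup>+z\<in>{y<..<x}. ennreal (S n z) \<partial>lebesgue)"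
    unfolding Sn using sum_bounded_below[of "{..<n}" "l * (x - y) / 8"] Gk by (intro ennreal_leI) auto
  also have "\<dots> \<le> mass (maximal_minus (\<lambda>s. w s * indicator {y<..<x} s)) y x"
    unfolding mass_def using S_le by (intro nn_integral_mono) (auto split: split_indicator)
  also have "\<dots> \<le> ennreal A * ennreal (F x - F y)" 
    using mult_pos_pos[OF l, of "x - y"] yx avg by (intro mass_maximal_minus_le) linarith+
  also have "\<dots> = ennreal (A * (l * (x - y)))" using A_nonneg l yx by (simp add: avg ennreal_mult)
  finally have "real n * (l * (x - y) / 8) \<le> A * (l * (x - y))"
    using A_nonneg l yx by simp
  then have "(real n / 8) * (l * (x - y)) \<le> A * (l * (x - y))" by simp
  then have "real n / 8 \<le> A" using l yx by (simp only: mult_le_cancel_right) auto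
  then show False using n by simp
qed

section \<open>Geometric decay of mounds\<close>

text \<open>
  Let $G$ be the mound of level $t$ and $H \subseteq G$ the one of level $\kappa t$, where
  $\kappa = \alpha/4$. At least the proportion $\alpha$ of $G$ has $w > t/2$, but in $H$ this
  happens on at most the proportion $2\kappa$, since $w(H) = \kappa t |H|$. Hence
  $(1 - \alpha/2) |H| \le (1 - \alpha) |G|$. The anchor hypothesis gives the left-hand condition
  for all levels below $l$ at once, and so $H \subseteq G$.
\<close>
lemma mound_contracts:
  assumes n: "8 * A < real n"
    and anchor: "\<And>z. a < z \<Longrightarrow> z < c \<Longrightarrow> l * (z - a) \<le> F z - F a"
    and t: "0 < t" "t < l"
  shows "measure lebesgue (mound ((1 / 2) ^ (n + 4) * t) a c)
    \<le> (1 - (1 / 2) ^ (n + 2) / 2) * measure lebesgue (mound t a c)"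
proof -
  define \<alpha> :: real where "\<alpha> = (1 / 2) ^ (n + 2)"
  have \<alpha>: "0 < \<alpha>" "\<alpha> \<le> 1" "(1 / 2) ^ (n + 4) = \<alpha> / 4"
    unfolding \<alpha>_def by (simp, rule power_le_one, simp_all add: power_add power4_eq_xxxx power2_eq_square)
  define G where "G = mound t a c"
  define H where "H = mound (\<alpha> / 4 * t) a c"
  define E where "E = {z \<in> {a<..<c}. w z \<le> t / 2}"
  have E: "E \<in> sets lebesgue" unfolding E_def by (rule sets_level) simp
  have G: "G \<in> sets lebesgue" "G \<subseteq> {a<..<c}" and H: "H \<in> sets lebesgue" "H \<subseteq> {a<..<c}"
    using mound_subset by (auto simp: G_def H_def)
  have le_t: "\<alpha> / 4 * t \<le> t" using \<alpha> t by (simp add: mult_le_cancel_right1)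
  have HG: "H \<subseteq> G"
  proof
    fix z assume z: "z \<in> H"
    then obtain v where v: "z < v" "v \<le> c" "F v - F z < \<alpha> / 4 * t * (v - z)"
      by (auto simp: H_def mound_def)
    have zac: "a < z" "z < c" using z H by auto
    have "t * (z - a) < l * (z - a)" using t zac by simp
    also have "\<dots> \<le> F z - F a" using anchor zac by simp
    finally have "t * (z - a) < F z - F a" .
    moreover have "\<alpha> / 4 * t * (v - z) \<le> t * (v - z)" using le_t v by (intro mult_right_mono) auto
    ultimately show "z \<in> G" using v zac by (force simp: G_def mound_def)
  qed
  have EG: "measure lebesgue (E \<inter> G) \<le> (1 - \<alpha>) * measure lebesgue G"
  proof -
    let ?M = "density lebesgue (indicator E)" and ?N = "density lebesgue (\<lambda>_. ennreal (1 - \<alpha>))"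
    have M: "emeasure ?M X = emeasure lebesgue (E \<inter> X)" if "X \<in> sets lebesgue" for X
      using E that by (rule emeasure_restricted)
    have N: "emeasure ?N X = ennreal (1 - \<alpha>) * emeasure lebesgue X" if "X \<in> sets lebesgue" for X
      using that by (simp add: emeasure_density_const)
    have "emeasure ?M G \<le> emeasure ?N G"
    proof (rule emeasure_open_le_if_components_le[of _ _ _ a c])
      fix y x assume yx: "a \<le> y" "y < x" "x \<le> c" "y \<notin> G" "x \<notin> G" "{y<..<x} \<subseteq> G"
      define X where "X = {z \<in> {y<..<x}. t / 2 < w z}"
      have X: "X \<in> sets lebesgue" "X \<subseteq> {y<..<x}" unfolding X_def by (rule sets_level; simp) auto
      note comp = mound_component[OF yx(2) yx(4-6)[unfolded G_def]]
      have "\<alpha> * (x - y) \<le> measure lebesgue X"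
        unfolding \<alpha>_def X_def using n t(1) yx(2) comp by (rule measure_above_half_average_ge)
      moreover have "E \<inter> {y<..<x} = {y<..<x} - X" using yx by (auto simp: E_def X_def)
      moreover have "measure lebesgue ({y<..<x} - X) = measure lebesgue {y<..<x} - measure lebesgue X"
        using X yx by (intro measure_Diff) auto
      ultimately have "measure lebesgue (E \<inter> {y<..<x}) \<le> (1 - \<alpha>) * (x - y)"
        using yx by (simp add: algebra_simps)
      moreover have "emeasure lebesgue (E \<inter> {y<..<x}) = ennreal (measure lebesgue (E \<inter> {y<..<x}))"
        using E by (intro emeasure_lebesgue_bounded[of _ y x]) auto
      ultimately show "emeasure ?M {y<..<x} \<le> emeasure ?N {y<..<x}"
        using yx \<alpha> by (simp add: M N ennreal_leI flip: ennreal_mult)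
    qed (use open_mound G in \<open>auto simp: G_def\<close>)
    then have "emeasure lebesgue (E \<inter> G) \<le> ennreal (1 - \<alpha>) * emeasure lebesgue G"
      using G by (simp add: M N)
    then show ?thesis
      using emeasure_lebesgue_bounded[OF G] emeasure_lebesgue_bounded[of "E \<inter> G" a c] E G \<alpha>
      by (simp add: le_infI2 flip: ennreal_mult)
  qed
  have D: "H - E \<in> sets lebesgue" "H - E \<subseteq> {a<..<c}" using H E by auto
  have "t / 2 * measure lebesgue (H - E) \<le> measure \<nu> (H - E)"
    using t H by (intro measure_\<nu>_ge[OF D] AE_I2) (auto simp: E_def)
  also have "\<dots> \<le> measure \<nu> H"
    using D fmeasurable_bounded(2)[OF H] by (intro measure_mono_fmeasurable) auto
  also have "\<dots> = \<alpha> / 4 * t * measure lebesgue H"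
    unfolding H_def using \<alpha> t by (intro measure_\<nu>_mound) auto
  finally have "t * measure lebesgue (H - E) \<le> t * (\<alpha> / 2 * measure lebesgue H)" by (simp add: mult_ac)
  then have HE: "measure lebesgue (H - E) \<le> \<alpha> / 2 * measure lebesgue H" using t by simp
  have "measure lebesgue H \<le> measure lebesgue ((H - E) \<union> (E \<inter> G))"
    using H E G HG fmeasurable_bounded(1)[of "(H - E) \<union> (E \<inter> G)" a c]
    by (intro measure_mono_fmeasurable) auto
  also have "\<dots> \<le> measure lebesgue (H - E) + measure lebesgue (E \<inter> G)"
    using D E G by (intro measure_Un_le) auto
  finally have "(1 - \<alpha> / 2) * measure lebesgue H \<le> (1 - \<alpha>) * measure lebesgue G"
    using HE EG by (simp add: algebra_simps)
  also have "\<dots> \<le> (1 - \<alpha> / 2) * (1 - \<alpha> / 2) * measure lebesgue G"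
    by (intro mult_right_mono) (auto simp: algebra_simps)
  finally have "(1 - \<alpha> / 2) * measure lebesgue H \<le> (1 - \<alpha> / 2) * ((1 - \<alpha> / 2) * measure lebesgue G)" by simp
  then have "measure lebesgue H \<le> (1 - \<alpha> / 2) * measure lebesgue G"
    using \<alpha> by (simp add: mult_le_cancel_left)
  then show ?thesis unfolding H_def G_def \<alpha>(3)[symmetric] by (simp only: \<alpha>_def)
qed

lemma mound_decay:
  assumes n: "8 * A < real n" and "a \<le> c"
    and anchor: "\<And>z. a < z \<Longrightarrow> z < c \<Longrightarrow> l * (z - a) \<le> F z - F a"
    and t: "0 < t" "t < l"
  shows "measure lebesgue (mound (((1 / 2) ^ (n + 4)) ^ k * t) a c) \<le> (1 - (1 / 2) ^ (n + 2) / 2) ^ k * (c - a)"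
proof (induction k)
  case 0
  have "measure lebesgue (mound t a c) \<le> measure lebesgue {a<..<c}"
    using mound_subset by (intro measure_mono_fmeasurable) auto
  then show ?case using assms(2) by simp
next
  case (Suc k)
  let ?t = "((1 / 2) ^ (n + 4)) ^ k * t"
  have "(((1 / 2) ^ (n + 4)) ^ k :: real) \<le> 1" by (intro power_le_one) auto
  then have "?t \<le> t" using t by (simp add: mult_le_cancel_right1)
  moreover have "0 < ?t" using t by simp
  ultimately have "measure lebesgue (mound ((1 / 2) ^ (n + 4) * ?t) a c)
      \<le> (1 - (1 / 2) ^ (n + 2) / 2) * measure lebesgue (mound ?t a c)"
    using t by (intro mound_contracts[OF n anchor _ le_less_trans])
  also have "\<dots> \<le> (1 - (1 / 2) ^ (n + 2) / 2) * ((1 - (1 / 2) ^ (n + 2) / 2) ^ k * (c - a))"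
  proof (rule mult_left_mono[OF Suc.IH])
    have "((1 / 2) ^ (n + 2) :: real) \<le> 1" by (intro power_le_one) auto
    then show "0 \<le> 1 - (1 / 2) ^ (n + 2) / (2::real)" by simp
  qed
  finally show ?case by (simp add: mult.assoc)
qed

end

section \<open>Integrals of negative powers of the weight\<close>

lemma ennpowr_le:
  assumes "x \<le> ennreal y" "0 < y" "0 < r"
  shows "ennpowr x r \<le> ennreal (y powr r)"
proof -
  obtain x' where x': "x = ennreal x'" "0 \<le> x'" using assms(1) by (cases x) (auto simp: top_unique)
  then have "x' \<le> y" using assms by (simp add: ennreal_le_iff)
  then show ?thesis using x' assms by (auto simp: ennpowr_def intro!: ennreal_leI powr_mono2)
qed

lemma ennpowr_uminus_le:
  assumes "0 < y" "y \<le> x" "0 < r"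
  shows "ennpowr (ennreal x) (- r) \<le> ennreal (y powr (- r))"
  using assms by (auto simp: ennpowr_def intro!: ennreal_leI powr_mono2')

lemma exp_le_one_plus_double:
  fixes x :: real
  assumes "0 \<le> x" "x \<le> 1"
  shows "exp x \<le> 1 + 2 * x"
proof -
  have "x\<^sup>2 \<le> x" using assms by (simp add: power2_eq_square mult_left_le)
  then show ?thesis using exp_bound[OF assms] by linarith
qed

context weight_A_inf begin

text \<open>
  Let $\kappa = e^{-L}$ and $r = \kappa^{-s}$. Almost every point of $(b,c)$ with
  $\kappa^N t \le w < \kappa^{N-1} t$ lies in the mounds $D_0, \dots, D_{N-1}$, and
  $w^{-s} \le t^{-s} r^N = t^{-s} (1 + \sum_{k<N} (r^{k+1} - r^k))$.
  So $w^{-s}$ is at most $t^{-s}$ times the sum of $1$ and all $(r^{k+1} - r^k) 1_{D_k}$. Its integral is a geometric series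
  with ratio $r \rho$, where $\rho = 1 - \alpha/2$; the smallness of $s L$ keeps
  $r \rho \le 1 - \alpha/4$. The factor $r - 1 \le 2 s L$ that remains in front is what makes the
  bound of the form $1 + s B$.
\<close>
lemma dual_integral_le:
  fixes n :: nat
  defines "\<alpha> \<equiv> (1 / 2 :: real) ^ (n + 2)" and "L \<equiv> real (n + 4) * ln 2"
  assumes n: "8 * A < real n"
    and abc: "a \<le> b" "b < c"
    and anchor: "\<And>z. a < z \<Longrightarrow> z < c \<Longrightarrow> l * (z - a) \<le> F z - F a"
    and t: "0 < t" "t < l"
    and s: "0 < s" "s * L \<le> \<alpha> / 8"
  shows "(\<integral>\<^sup>+z\<in>{b<..<c}. ennpowr (ennreal (w z)) (- s) \<partial>lebesgue)
    \<le> ennreal (t powr (- s) * ((c - a) * (1 + 8 * s * L / \<alpha>)))"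
proof -
  define \<kappa> :: real where "\<kappa> = (1 / 2) ^ (n + 4)"
  define r where "r = \<kappa> powr (- s)"
  define \<rho> where "\<rho> = 1 - \<alpha> / 2"
  define D where "D k = mound (\<kappa> ^ k * t) a c" for k
  have \<alpha>: "0 < \<alpha>" "\<alpha> \<le> 1" unfolding \<alpha>_def by (simp, rule power_le_one) simp_all
  have \<kappa>: "0 < \<kappa>" "\<kappa> < 1"
    using power_strict_decreasing[of 0 "n + 4" "1 / 2 :: real"] by (simp_all add: \<kappa>_def)
  have L: "0 < L" by (simp add: L_def)
  have r_exp: "r = exp (s * L)"
    by (simp add: r_def \<kappa>_def L_def powr_def ln_realpow ln_div)
  have r1: "1 < r" using s L by (simp add: r_exp)
  have r_le: "r \<le> 1 + 2 * (s * L)"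
    unfolding r_exp using s L \<alpha> by (intro exp_le_one_plus_double) auto
  have r\<rho>: "r * \<rho> \<le> 1 - \<alpha> / 4"
  proof -
    have "r * \<rho> \<le> (1 + \<alpha> / 4) * (1 - \<alpha> / 2)"
      unfolding \<rho>_def using r_le s \<alpha> by (intro mult_right_mono) auto
    also have "\<dots> \<le> 1 - \<alpha> / 4" using \<alpha> by (simp add: algebra_simps)
    finally show ?thesis .
  qed
  have \<rho>: "0 \<le> \<rho>" using \<alpha> by (simp add: \<rho>_def)
  have r\<rho>0: "0 \<le> r * \<rho>" using r1 \<rho> by simp
  define g where "g k = r ^ Suc k - r ^ k" for k
  have g: "0 \<le> g k" for k using r1 by (simp add: g_def)
  define R where "R z = 1 + (\<Sum>k. ennreal (g k) * indicator (D k) z)" for z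
  have R_ge: "ennreal (r ^ N) \<le> R z" if "\<And>k. k < N \<Longrightarrow> z \<in> D k" for N z
  proof -
    have "r ^ N = 1 + (\<Sum>k<N. g k)" 
      unfolding g_def using sum_lessThan_telescope[of "\<lambda>k. r ^ k" N] by simp
    then have "ennreal (r ^ N) = 1 + (\<Sum>k<N. ennreal (g k))"
      using g by (simp add: ennreal_plus sum_nonneg)
    also have "(\<Sum>k<N. ennreal (g k)) = (\<Sum>k<N. ennreal (g k) * indicator (D k) z)"
      using that by (intro sum.cong) auto
    also have "\<dots> \<le> (\<Sum>k. ennreal (g k) * indicator (D k) z)" by (intro sum_le_suminf) auto
    finally show ?thesis by (simp add: R_def add_left_mono)
  qed
  have pt: "ennpowr (ennreal (w z)) (- s) \<le> ennreal (t powr (- s)) * R z"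
    if D: "\<And>k. w z < \<kappa> ^ k * t \<Longrightarrow> z \<in> D k" for z
  proof (cases "w z = 0")
    case True
    (* A zero of w lies in every D k, and the partial sums r ^ N are unbounded. *)
    have "R z = \<infinity>"
    proof (rule ccontr)
      assume "R z \<noteq> \<infinity>"
      then obtain m where m: "R z = ennreal m" "0 \<le> m" by (cases "R z") auto
      obtain N where "m < r ^ N" using real_arch_pow[OF r1] by blast
      moreover have "ennreal (r ^ N) \<le> R z" using D True \<kappa> t by (intro R_ge) auto
      ultimately show False using m by (simp add: ennreal_le_iff)
    qed
    then show ?thesis using t by (simp add: ennreal_mult_top)
  next
    case False
    then have wz: "0 < w z" using w_nonneg[of z] by simp
    define N where "N = (LEAST k. \<kappa> ^ k * t \<le> w z)"
    obtain k0 where "\<kappa> ^ k0 < w z / t" using real_arch_pow_inv[of "w z / t" \<kappa>] wz t \<kappa> by auto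
    then have "\<kappa> ^ k0 * t \<le> w z" using t by (simp add: field_simps)
    then have N: "\<kappa> ^ N * t \<le> w z" unfolding N_def by (rule LeastI)
    have "ennpowr (ennreal (w z)) (- s) \<le> ennreal ((\<kappa> ^ N * t) powr (- s))"
      using N \<kappa> t s by (intro ennpowr_uminus_le) auto
    also have "(\<kappa> ^ N * t) powr (- s) = t powr (- s) * r ^ N"
    proof -
      have "(\<kappa> ^ N) powr (- s) = r ^ N"
        unfolding r_def using \<kappa> by (simp add: powr_powr mult.commute flip: powr_realpow)
      then show ?thesis using \<kappa> t by (simp add: powr_mult)
    qed
    also have "ennreal (t powr (- s) * r ^ N) = ennreal (t powr (- s)) * ennreal (r ^ N)"
      using r1 by (intro ennreal_mult) auto
    also have "\<dots> \<le> ennreal (t powr (- s)) * R z"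
    proof (intro mult_left_mono R_ge)
      fix k assume "k < N"
      then show "z \<in> D k" unfolding N_def by (intro D) (auto dest: not_less_Least)
    qed simp
    finally show ?thesis .
  qed
  have "AE z in lebesgue. \<forall>k. z \<in> {a<..<c} \<longrightarrow> w z < \<kappa> ^ k * t \<longrightarrow>
      (\<exists>v\<in>{z<..c}. F v - F z < \<kappa> ^ k * t * (v - z))"
    using \<kappa> t by (subst AE_all_countable) (intro allI AE_right_average_lt, simp)
  then have AE: "AE z in lebesgue. z \<in> {b<..<c} \<longrightarrow> ennpowr (ennreal (w z)) (- s) \<le> ennreal (t powr (- s)) * R z"
  proof (rule eventually_mono, intro impI pt)
    fix z k
    assume ev: "\<forall>k. z \<in> {a<..<c} \<longrightarrow> w z < \<kappa> ^ k * t \<longrightarrow> (\<exists>v\<in>{z<..c}. F v - F z < \<kappa> ^ k * t * (v - z))"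
      and z: "z \<in> {b<..<c}" and wz: "w z < \<kappa> ^ k * t"
    have zac: "a < z" "z < c" using z abc by auto
    have "\<kappa> ^ k \<le> 1" using \<kappa> by (intro power_le_one) auto
    then have "\<kappa> ^ k * t \<le> t" using t by (simp add: mult_le_cancel_right1)
    also have "t < l" by (rule t)
    finally have "\<kappa> ^ k * t * (z - a) < l * (z - a)" using zac by simp
    also have "\<dots> \<le> F z - F a" using anchor zac by simp
    finally show "z \<in> D k" using ev wz zac by (auto simp: D_def mound_def intro!: bexI[of _ a])
  qed
  have D_meas: "emeasure lebesgue (D k) \<le> ennreal (\<rho> ^ k * (c - a))" for k
  proof -
    have "emeasure lebesgue (D k) = ennreal (measure lebesgue (D k))"
      unfolding D_def by (rule emeasure_lebesgue_bounded[OF sets_mound mound_subset])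
    also have "\<dots> \<le> ennreal (\<rho> ^ k * (c - a))"
      using mound_decay[OF n _ anchor t, where k = k] abc
      by (intro ennreal_leI) (simp add: D_def \<kappa>_def \<rho>_def \<alpha>_def)
    finally show ?thesis .
  qed
  have sums: "(\<lambda>k. (r - 1) * (c - a) * (r * \<rho>) ^ k) sums ((r - 1) * (c - a) * (1 / (1 - r * \<rho>)))"
    using r\<rho> \<alpha> r\<rho>0 by (intro sums_mult geometric_sums) simp
  have [measurable]: "D k \<in> sets lebesgue" "{b<..<c} \<in> sets lebesgue" for k by (simp_all add: D_def)
  have "(\<integral>\<^sup>+z\<in>{b<..<c}. ennpowr (ennreal (w z)) (- s) \<partial>lebesgue)
      \<le> (\<integral>\<^sup>+z\<in>{b<..<c}. ennreal (t powr (- s)) * R z \<partial>lebesgue)"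
    using AE by (intro nn_integral_mono_AE) (auto elim!: eventually_mono split: split_indicator)
  also have "\<dots> \<le> (\<integral>\<^sup>+z. ennreal (t powr (- s)) *
      (indicator {b<..<c} z + (\<Sum>k. ennreal (g k) * indicator (D k) z)) \<partial>lebesgue)"
    by (intro nn_integral_mono) (auto simp: R_def split: split_indicator)
  also have "\<dots> = ennreal (t powr (- s)) * (\<integral>\<^sup>+z.
      (indicator {b<..<c} z + (\<Sum>k. ennreal (g k) * indicator (D k) z)) \<partial>lebesgue)"
    by (intro nn_integral_cmult) measurable
  also have "(\<integral>\<^sup>+z. (indicator {b<..<c} z + (\<Sum>k. ennreal (g k) * indicator (D k) z)) \<partial>lebesgue)
      = emeasure lebesgue {b<..<c} + (\<Sum>k. ennreal (g k) * emeasure lebesgue (D k))"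
    by (subst nn_integral_add) (simp_all add: nn_integral_suminf nn_integral_cmult_indicator)
  also have "\<dots> \<le> ennreal (c - a) + ennreal ((r - 1) * (c - a) * (1 / (1 - r * \<rho>)))"
  proof (rule add_mono)
    show "emeasure lebesgue {b<..<c} \<le> ennreal (c - a)" using abc by (simp add: ennreal_leI)
    have "(\<Sum>k. ennreal (g k) * emeasure lebesgue (D k)) \<le> (\<Sum>k. ennreal ((r - 1) * (c - a) * (r * \<rho>) ^ k))"
    proof (rule suminf_le)
      fix k
      have "ennreal (g k) * emeasure lebesgue (D k) \<le> ennreal (g k) * ennreal (\<rho> ^ k * (c - a))"
        by (intro mult_left_mono D_meas) simp
      also have "\<dots> = ennreal (g k * (\<rho> ^ k * (c - a)))"
        using g \<rho> abc by (intro ennreal_mult[symmetric]) auto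
      also have "g k * (\<rho> ^ k * (c - a)) = (r - 1) * (c - a) * (r * \<rho>) ^ k"
        by (simp add: g_def algebra_simps power_mult_distrib)
      finally show "ennreal (g k) * emeasure lebesgue (D k) \<le> ennreal ((r - 1) * (c - a) * (r * \<rho>) ^ k)" .
    qed auto
    also have "\<dots> = ennreal ((r - 1) * (c - a) * (1 / (1 - r * \<rho>)))"
      using r1 \<rho> abc by (intro suminf_ennreal_eq sums) auto
    finally show "(\<Sum>k. ennreal (g k) * emeasure lebesgue (D k)) \<le> \<dots>" .
  qed
  also have "\<dots> = ennreal ((c - a) + (r - 1) * (c - a) * (1 / (1 - r * \<rho>)))"
    using r1 r\<rho> \<alpha> abc by (intro ennreal_plus[symmetric]) auto
  also have "\<dots> \<le> ennreal ((c - a) * (1 + 8 * s * L / \<alpha>))"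
  proof (rule ennreal_leI)
    have "1 / (1 - r * \<rho>) \<le> 1 / (\<alpha> / 4)"
      using r\<rho> \<alpha> by (intro divide_left_mono mult_pos_pos) auto
    then have "(r - 1) * (1 / (1 - r * \<rho>)) \<le> (2 * (s * L)) * (1 / (\<alpha> / 4))"
      using r1 r_le r\<rho> \<alpha> s L by (intro mult_mono) auto
    also have "\<dots> = 8 * s * L / \<alpha>" by simp
    finally have "(c - a) * (1 + (r - 1) * (1 / (1 - r * \<rho>))) \<le> (c - a) * (1 + 8 * s * L / \<alpha>)"
      using abc by (intro mult_left_mono) auto
    then show "(c - a) + (r - 1) * (c - a) * (1 / (1 - r * \<rho>)) \<le> (c - a) * (1 + 8 * s * L / \<alpha>)"
      by (simp only: distrib_left mult_1_right mult.assoc mult.left_commute[of "r - 1"])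
  qed
  finally have "(\<integral>\<^sup>+z\<in>{b<..<c}. ennpowr (ennreal (w z)) (- s) \<partial>lebesgue)
      \<le> ennreal (t powr (- s)) * ennreal ((c - a) * (1 + 8 * s * L / \<alpha>))"
    by (simp add: mult_left_mono)
  then show ?thesis using abc s L \<alpha> by (simp add: ennreal_mult)
qed

section \<open>The one-sided Muckenhoupt constant\<close>

text \<open>
  A minimum point of $F(z) - l z$ on $[a,b]$. On $(b,c)$ this function is not below its value at $a$,
  because $F$ has already grown by at least $l\,(c - a)$ at $b$.
\<close>
lemma exists_anchor:
  assumes abc: "a < b" "b < c" and l: "0 \<le> l" "l * (c - a) \<le> F b - F a"
  obtains a' where "a \<le> a'" "a' \<le> b" "\<And>z. a' < z \<Longrightarrow> z < c \<Longrightarrow> l * (z - a') \<le> F z - F a'"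
proof -
  have "continuous_on {a..b} (\<lambda>z. F z - l * z)"
    by (intro continuous_intros continuous_on_subset[OF F_continuous]) auto
  then obtain a' where a': "a' \<in> {a..b}" "\<And>z. z \<in> {a..b} \<Longrightarrow> F a' - l * a' \<le> F z - l * z"
    using continuous_attains_inf[of "{a..b}" "\<lambda>z. F z - l * z"] abc by auto
  show thesis
  proof (rule that)
    fix z assume z: "a' < z" "z < c"
    show "l * (z - a') \<le> F z - F a'"
    proof (cases "z \<le> b")
      case True
      then show ?thesis using a'(2)[of z] a'(1) z by (simp add: algebra_simps)
    next
      case False
      have "l * (z - a) \<le> l * (c - a)" using l z by (intro mult_left_mono) auto
      also have "\<dots> \<le> F z - F a" using l(2) monoD[OF F_mono, of b z] False by simp
      finally show ?thesis using a'(2)[of a] abc by (simp add: algebra_simps)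
    qed
  qed (use a'(1) in auto)
qed

text \<open>
  With $t = l/2$ and $s = 1/(p-1)$, the expression is at most
  $l \cdot (t^{-s} (1 + s B))^{1/s} \le (l/t)\, e^B$.
\<close>
lemma A_p_expression_le:
  fixes n :: nat
  defines "B \<equiv> 8 * (real (n + 4) * ln 2) * 2 ^ (n + 2)"
  assumes n: "8 * A < real n"
    and abc: "a < b" "b < c" and pos: "F a < F b"
    and p: "B \<le> p - 1"
  shows "mass (\<lambda>t. ennreal (w t)) a b / ennreal (c - a) *
    ennpowr (mass (dual_weight p w) b c / ennreal (c - a)) (p - 1) \<le> ennreal (2 * exp B)"
proof -
  define s where "s = 1 / (p - 1)"
  define l where "l = (F b - F a) / (c - a)"
  define t where "t = l / 2"
  have B: "0 < B" by (simp add: B_def)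
  have p1: "0 < p - 1" using B p by linarith
  have s: "0 < s" using p1 by (simp add: s_def)
  have sB: "8 * s * (real (n + 4) * ln 2) / (1 / 2) ^ (n + 2) = s * B"
    by (simp add: B_def power_divide)
  have "s * B \<le> 1" using p p1 by (simp add: s_def)
  then have s_small: "s * (real (n + 4) * ln 2) \<le> (1 / 2) ^ (n + 2) / 8"
    by (simp add: B_def power_divide field_simps)
  have l: "0 < l" using abc pos by (simp add: l_def)
  have t: "0 < t" "t < l" using l by (auto simp: t_def)
  have "l * (c - a) = F b - F a" using abc by (simp add: l_def)
  then obtain a' where a': "a \<le> a'" "a' \<le> b"
    and anchor: "\<And>z. a' < z \<Longrightarrow> z < c \<Longrightarrow> l * (z - a') \<le> F z - F a'"
    using exists_anchor[OF abc, of l] l by auto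
  have e: "- 1 / (p - 1) = - s" by (simp add: s_def)
  have "mass (dual_weight p w) b c \<le> ennreal (t powr (- s) * ((c - a') * (1 + s * B)))"
    using dual_integral_le[OF n a'(2) abc(2) anchor t s s_small] unfolding sB
    by (simp only: mass_def dual_weight_def e)
  also have "\<dots> \<le> ennreal (t powr (- s) * ((c - a) * (1 + s * B)))"
    using a' s B abc by (intro ennreal_leI mult_left_mono mult_right_mono) auto
  finally have "mass (dual_weight p w) b c / ennreal (c - a)
      \<le> ennreal (t powr (- s) * ((c - a) * (1 + s * B))) / ennreal (c - a)"
    by (rule divide_right_mono_ennreal)
  also have "\<dots> = ennreal (t powr (- s) * (1 + s * B))"
    using abc s B by (simp add: divide_ennreal)
  finally have "ennpowr (mass (dual_weight p w) b c / ennreal (c - a)) (p - 1)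
      \<le> ennreal ((t powr (- s) * (1 + s * B)) powr (p - 1))"
    using p1 t s B by (intro ennpowr_le) (auto intro!: mult_pos_pos add_pos_nonneg)
  also have "(t powr (- s) * (1 + s * B)) powr (p - 1) \<le> exp B / t"
  proof -
    have "- s * (p - 1) = - 1" using p1 by (simp add: s_def)
    then have "(t powr (- s)) powr (p - 1) = 1 / t"
      using t by (simp only: powr_powr powr_neg_one)
    moreover have "(1 + s * B) powr (p - 1) \<le> exp (s * B) powr (p - 1)"
      using p1 s B by (intro powr_mono2) auto
    moreover have "exp (s * B) powr (p - 1) = exp B"
      using p1 by (simp add: powr_def s_def)
    ultimately show ?thesis
      using t s B by (simp add: powr_mult divide_right_mono)
  qed
  finally have 1: "ennpowr (mass (dual_weight p w) b c / ennreal (c - a)) (p - 1) \<le> ennreal (exp B / t)"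
    by (simp add: ennreal_leI)
  have 2: "mass (\<lambda>t. ennreal (w t)) a b / ennreal (c - a) = ennreal l"
    using abc pos by (simp add: mass_eq divide_ennreal l_def)
  have "mass (\<lambda>t. ennreal (w t)) a b / ennreal (c - a) *
      ennpowr (mass (dual_weight p w) b c / ennreal (c - a)) (p - 1) \<le> ennreal l * ennreal (exp B / t)"
    unfolding 2 using 1 by (rule mult_left_mono) simp
  also have "\<dots> = ennreal (2 * exp B)" using l by (simp add: t_def flip: ennreal_mult)
  finally show ?thesis .
qed

text \<open>
  With $8 A < n \le 8 A + 1$ and $A \ge 1$, the crude bounds $n + 4 \le e^{n+3}$ and $2 \le e$ give
  $B + 1 \le e^{2n+9} \le e^{27 A}$.
\<close>
lemma A_p_const_le:
  assumes p: "exp (27 * A) < p"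
  shows "A_p_const p w \<le> ennreal (exp (exp (27 * A)))"
  unfolding A_p_const_def
proof (rule SUP_least)
  fix i :: "real \<times> real \<times> real"
  assume "i \<in> {(a, b, c). a < b \<and> b < c}"
  then obtain a b c where i: "i = (a, b, c)" and abc: "a < b" "b < c" by auto
  have "mass (\<lambda>t. ennreal (w t)) a b / ennreal (c - a) *
      ennpowr (mass (dual_weight p w) b c / ennreal (c - a)) (p - 1) \<le> ennreal (exp (exp (27 * A)))"
  proof (cases "F a < F b")
    case False
    then show ?thesis using abc monoD[OF F_mono, of a b] by (simp add: mass_eq)
  next
    case True
    then have A1: "1 \<le> A" using A_ge_1 abc by blast
    define n where "n = nat \<lfloor>8 * A\<rfloor> + 1"
    have n: "8 * A < real n" "real n \<le> 8 * A + 1"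
      using A1 by (simp_all add: n_def) linarith+
    define B where "B = 8 * (real (n + 4) * ln 2) * (2::real) ^ (n + 2)"
    have e2: "(2::real) \<le> exp 1" using exp_ge_add_one_self[of 1] by simp
    have "B \<le> 8 * (real (n + 4) * 1) * 2 ^ (n + 2)"
      unfolding B_def using ln_2_less_1 by (intro mult_left_mono mult_right_mono) auto
    also have "\<dots> = real (n + 4) * 2 ^ (n + 5)" by (simp add: power_add)
    also have "\<dots> \<le> exp (real (n + 3)) * exp 1 ^ (n + 5)"
      using exp_ge_add_one_self[of "real (n + 3)"] e2 by (intro mult_mono power_mono) auto
    also have "\<dots> = exp (2 * real n + 8)" by (simp flip: exp_of_nat_mult exp_add)
    finally have "B + 1 \<le> exp (2 * real n + 8) + exp (2 * real n + 8)" by (intro add_mono) auto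
    also have "\<dots> \<le> exp (2 * real n + 8) * exp 1" using e2 by simp
    also have "\<dots> = exp (2 * real n + 9)" by (simp flip: exp_add)
    also have "\<dots> \<le> exp (27 * A)" using n(2) A1 by simp
    finally have B: "B + 1 \<le> exp (27 * A)" .
    have "mass (\<lambda>t. ennreal (w t)) a b / ennreal (c - a) *
        ennpowr (mass (dual_weight p w) b c / ennreal (c - a)) (p - 1) \<le> ennreal (2 * exp B)"
      unfolding B_def using B p by (intro A_p_expression_le[OF n(1) abc True]) (simp add: B_def)
    also have "\<dots> \<le> ennreal (exp (exp (27 * A)))"
    proof (rule ennreal_leI)
      have "2 * exp B \<le> exp 1 * exp B" using e2 by simp
      also have "\<dots> = exp (B + 1)" by (simp add: exp_add)
      also have "\<dots> \<le> exp (exp (27 * A))" using B by simp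
      finally show "2 * exp B \<le> exp (exp (27 * A))" .
    qed
    finally show ?thesis .
  qed
  then show "(case i of (a, b, c) \<Rightarrow> mass (\<lambda>t. ennreal (w t)) a b / ennreal (c - a) *
      ennpowr (mass (dual_weight p w) b c / ennreal (c - a)) (p - 1)) \<le> ennreal (exp (exp (27 * A)))"
    by (simp add: i)
qed

end

section \<open>Existence of the primitive and passage to the constants\<close>

lemma weight_has_primitive:
  assumes w: "weight w"
  obtains F where "weight_primitive w F"
proof -
  have nonneg: "0 \<le> w x" for x using w by (simp add: weight_def)
  have abs: "w absolutely_integrable_on {a..b}" for a b using w by (simp add: weight_def)
  have int: "w integrable_on {a..b}" for a b using abs by (rule set_lebesgue_integral_eq_integral(1))
  (* At most one of the two integrals is over a nontrivial interval. *)
  define F where "F x = integral {0..x} w - integral {x..0} w" for x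
  have diff: "F x - F y = integral {y..x} w" if "y \<le> x" for y x
  proof -
    have c: "integral {u..v} w + integral {v..z} w = integral {u..z} w" if "u \<le> v" "v \<le> z" for u v z
      using Henstock_Kurzweil_Integration.integral_combine[OF that int] .
    have z: "integral {u..v} w = 0" if "v \<le> u" for u v
      using that by (cases "u = v") auto
    consider "0 \<le> y" | "y \<le> 0" "0 \<le> x" | "x \<le> 0" by linarith
    then show ?thesis
    proof cases
      case 1
      then show ?thesis using that c[of 0 y x] by (simp add: F_def z)
    next
      case 2
      then show ?thesis using that c[of y 0 x] by (simp add: F_def z)
    next
      case 3
      then show ?thesis using that c[of y x 0] by (simp add: F_def z)
    qed
  qed
  have meas: "w \<in> borel_measurable lebesgue"
  proof -
    have 1: "(\<lambda>x. indicator {- real n..real n} x *\<^sub>R w x) \<in> borel_measurable lebesgue" for n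
      using abs[of "- real n" "real n"] unfolding set_integrable_def by (rule borel_measurable_integrable)
    have 2: "(\<lambda>n. indicator {- real n..real n} x *\<^sub>R w x) \<longlonglongrightarrow> w x" for x
    proof (rule tendsto_eventually)
      show "\<forall>\<^sub>F n in sequentially. indicator {- real n..real n} x *\<^sub>R w x = w x"
        using eventually_ge_at_top[of "nat \<lceil>\<bar>x\<bar>\<rceil>"]
        by eventually_elim (auto simp: indicator_def nat_le_iff ceiling_le_iff)
    qed
    show ?thesis by (rule borel_measurable_LIMSEQ_metric[OF 1 2])
  qed
  have "weight_primitive w F"
  proof
    show "0 \<le> w x" for x by (rule nonneg)
    show "w \<in> borel_measurable lebesgue" by (rule meas)
    show "mono F"
    proof
      fix y x :: real assume "y \<le> x"
      then show "F y \<le> F x"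
        using diff[of y x] Henstock_Kurzweil_Integration.integral_nonneg[OF int[of y x]] nonneg by simp
    qed
    show "continuous_on UNIV F"
    proof -
      have "continuous_on {a..b} F" for a b
      proof (rule continuous_on_eq)
        show "continuous_on {a..b} (\<lambda>x. F a + integral {a..x} w)"
          by (intro continuous_intros indefinite_integral_continuous_1 int)
        show "F a + integral {a..x} w = F x" if "x \<in> {a..b}" for x using diff[of a x] that by simp
      qed
      then have "continuous_on {x - 1<..<x + 1} F" for x
        by (rule continuous_on_subset[of "{x - 1..x + 1}"]) auto
      then have "isCont F x" for x
        by (rule continuous_on_interior[of "{x - 1<..<x + 1}"]) (auto simp: interior_open)
      then show ?thesis by (intro continuous_at_imp_continuous_on) auto
    qed
    show "mass (\<lambda>t. ennreal (w t)) a b = ennreal (F b - F a)" if ab: "a \<le> b" for a b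
    proof -
      have "(w has_integral F b - F a) {a<..<b}"
        using integrable_integral[OF int[of a b]] diff[OF ab] has_integral_open_interval[of w "F b - F a" a b]
        by (simp add: box_real)
      then have "integral\<^sup>N lborel (\<lambda>x. ennreal (w x) * indicator {a<..<b} x) = ennreal (F b - F a)"
        using nonneg by (intro nn_integral_has_integral_lebesgue') auto
      then show ?thesis by (simp add: mass_def nn_integral_completion)
    qed
  qed
  then show thesis by (rule that)
qed

text \<open>
  Extended nonnegative reals cancel only against factors that are positive and finite.
\<close>
lemma mass_maximal_le_A_inf_const:
  assumes "a < b" "0 < mass (\<lambda>t. ennreal (w t)) a b" "mass (\<lambda>t. ennreal (w t)) a b < \<infinity>"
  shows "mass (maximal_minus (\<lambda>t. w t * indicator {a<..<b} t)) a b
    \<le> A_inf_const w * mass (\<lambda>t. ennreal (w t)) a b" (is "?M \<le> _ * ?W")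
proof -
  have "?M / ?W \<le> A_inf_const w"
    unfolding A_inf_const_def using assms(1) by (intro SUP_upper2[of "(a, b)"]) auto
  then have "?M / ?W * ?W \<le> A_inf_const w * ?W" by (rule mult_right_mono) simp
  moreover have "?M / ?W * ?W = ?M"
    unfolding ennreal_divide_times using assms(2,3) by simp
  ultimately show ?thesis by simp
qed

theorem corollary1p3:
  shows "\<exists>c::real. c > 0 \<and>
    (\<forall>(w::real \<Rightarrow> real) (p::real). w \<in> A_inf_plus \<longrightarrow> p > exp (c * enn2real (A_inf_const w)) \<longrightarrow>
       w \<in> A_p_plus p \<and>
       A_p_const p w \<le> ennreal (exp (exp (c * enn2real (A_inf_const w)))))"
proof (intro exI[of _ 27] conjI allI impI)
  fix w :: "real \<Rightarrow> real" and p :: real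
  assume w: "w \<in> A_inf_plus" and p: "p > exp (27 * enn2real (A_inf_const w))"
  have wt: "weight w" and fin: "A_inf_const w < \<infinity>" using w by (auto simp: A_inf_plus_def)
  obtain F where "weight_primitive w F" using weight_has_primitive[OF wt] .
  then interpret weight_primitive w F .
  interpret weight_A_inf w F "enn2real (A_inf_const w)"
  proof
    fix a b :: real assume ab: "a < b" and F: "F a < F b"
    show "mass (maximal_minus (\<lambda>t. w t * indicator {a<..<b} t)) a b
        \<le> ennreal (enn2real (A_inf_const w)) * ennreal (F b - F a)"
      using mass_maximal_le_A_inf_const[of a b w] ab F fin by (simp add: mass_eq)
  qed simp
  show le: "A_p_const p w \<le> ennreal (exp (exp (27 * enn2real (A_inf_const w))))"
    using p by (rule A_p_const_le)
  then show "w \<in> A_p_plus p"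
    using wt by (auto simp: A_p_plus_def intro: le_less_trans)
qed simp

end
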